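(* Let $\Gamma_1,\Gamma_2$ be non-empty sets of cycles and let $G$ be a $(\Gamma_1,\Gamma_2)$-critical graph. Assume that either - $\gamma^1\geq 5$ and $\gamma^2=3$, or - $\gamma^1\geq 6$, $\gamma^2=5$, and $\gamma_e^2\geq 8$. Then $G$ is blue bipartite.
   Context: All graphs are finite, simple and undirected; $C_k$ ($k\ge 3$) is the cycle of length $k$. A red-blue graph is a complete graph with each edge coloured red or blue; it is blue bipartite if the graph formed by its vertices and blue edges is bipartite. $R(\Gamma_1,\Gamma_2)$ is the least positive integer $N$ such that each red-blue graph on $N$ vertices contains a red subgraph from $\Gamma_1$ or a blue subgraph from $\Gamma_2$. A red-blue graph is $(\Gamma_1,\Gamma_2)$-avoiding if it contains neither a red subgraph from $\Gamma_1$ nor a blue subgraph from $\Gamma_2$; it is $(\Gamma_1,\Gamma_2)$-critical if moreover it has $R(\Gamma_1,\Gamma_2)-1$ vertices. For $i\in\{1,2\}$, $\gamma^i=\min\{k\mid C_k\in\Gamma_i\}$ and $\gamma_e^i=\min\{k \text{ even}\mid C_k\in\Gamma_i\}$, with $\gamma_e^i=\infty$ if $\Gamma_i$ contains no even cycle. *)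

theory Defs
  imports Main "HOL-Library.Ramsey" "HOL-Library.Extended_Nat"
begin

text \<open>
  A graph is a pair of a vertex set and a set of two-element edges. Sets of cycles are understood up
  to isomorphism, so the cycle of length \<open>k\<close> is represented by one fixed copy on
  \<open>{0, \<dots>, k - 1}\<close>; distinct lengths give distinct graphs.
\<close>

type_synonym 'a graph = "'a set \<times> 'a set set"

definition cycle_graph :: "nat \<Rightarrow> nat graph" where
  "cycle_graph k = ({..<k}, {{i, Suc i mod k} | i. i < k})"

definition cycles :: "nat graph set" where
  "cycles = {cycle_graph k | k. k \<ge> 3}"

definition contains_copy :: "'a graph \<Rightarrow> 'b graph \<Rightarrow> bool" where
  "contains_copy G H \<longleftrightarrow>
     (\<exists>f. inj_on f (fst H) \<and> f ` fst H \<subseteq> fst G \<and> (\<forall>e\<in>snd H. f ` e \<in> snd G))"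

definition bipartite :: "'a graph \<Rightarrow> bool" where
  "bipartite G \<longleftrightarrow>
     (\<exists>A B. A \<union> B = fst G \<and> A \<inter> B = {} \<and> (\<forall>e\<in>snd G. \<exists>a\<in>A. \<exists>b\<in>B. e = {a, b}))"

datatype colour = Red | Blue

text \<open>
  The edges of a red-blue graph are all two-element subsets of its vertex set; the values of
  \<open>edge_colour\<close> on other sets are irrelevant.
\<close>

record 'a red_blue_graph =
  vertices :: "'a set"
  edge_colour :: "'a set \<Rightarrow> colour"

definition colour_graph :: "colour \<Rightarrow> 'a red_blue_graph \<Rightarrow> 'a graph" where
  "colour_graph c G = (vertices G, {e \<in> nsets (vertices G) 2. edge_colour G e = c})"

definition blue_bipartite :: "'a red_blue_graph \<Rightarrow> bool" where
  "blue_bipartite G \<longleftrightarrow> bipartite (colour_graph Blue G)"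

definition avoiding :: "'b graph set \<Rightarrow> 'c graph set \<Rightarrow> 'a red_blue_graph \<Rightarrow> bool" where
  "avoiding \<Gamma>1 \<Gamma>2 G \<longleftrightarrow>
     \<not> (\<exists>H\<in>\<Gamma>1. contains_copy (colour_graph Red G) H) \<and>
     \<not> (\<exists>H\<in>\<Gamma>2. contains_copy (colour_graph Blue G) H)"

text \<open>
  Natural numbers serve as vertices in the Ramsey number; this loses no generality, since every
  finite red-blue graph is isomorphic to one of this form.
\<close>

definition ramsey_number :: "'b graph set \<Rightarrow> 'c graph set \<Rightarrow> nat" where
  "ramsey_number \<Gamma>1 \<Gamma>2 =
     (LEAST N. N > 0 \<and>
       (\<forall>G :: nat red_blue_graph. finite (vertices G) \<and> card (vertices G) = N \<longrightarrow>
          (\<exists>H\<in>\<Gamma>1. contains_copy (colour_graph Red G) H) \<or>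
          (\<exists>H\<in>\<Gamma>2. contains_copy (colour_graph Blue G) H)))"

definition critical :: "'b graph set \<Rightarrow> 'c graph set \<Rightarrow> 'a red_blue_graph \<Rightarrow> bool" where
  "critical \<Gamma>1 \<Gamma>2 G \<longleftrightarrow>
     finite (vertices G) \<and> avoiding \<Gamma>1 \<Gamma>2 G \<and>
     card (vertices G) = ramsey_number \<Gamma>1 \<Gamma>2 - 1"

definition min_cycle :: "nat graph set \<Rightarrow> nat" where
  "min_cycle \<Gamma> = (LEAST k. k \<ge> 3 \<and> cycle_graph k \<in> \<Gamma>)"

text \<open>The infimum of the empty set in \<^typ>\<open>enat\<close> is \<open>\<infinity>\<close>.\<close>

definition min_even_cycle :: "nat graph set \<Rightarrow> enat" where
  "min_even_cycle \<Gamma> = Inf {enat k | k. k \<ge> 3 \<and> even k \<and> cycle_graph k \<in> \<Gamma>}"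

end

theory Submission
  imports Defs
begin

text \<open>
  A graph is blue bipartite iff its vertices are covered by two red cliques. Write
  \<open>m = \<gamma>\<^sup>1\<close>. Two red cliques of sizes \<open>m - 1\<close> and \<open>b\<close>, joined in blue, contain no blue cycles
  but even ones of length at most \<open>2 b\<close>; with \<open>b = 1\<close>, respectively \<open>b = 3\<close>, this shows that a
  critical graph has at least \<open>m\<close>, respectively \<open>m + 2\<close>, vertices. This turns out to be all that is
  needed: it remains to find a red \<open>C\<^sub>m\<close> in every graph of that order that is not blue bipartite.

  If there is no blue triangle, a red cycle extends by any vertex with two red neighbours on it
  (insertion or rotation), and a vertex with at most one red neighbour on a red cycle through all
  other vertices leads to two red cliques. A vertex-minimal graph that is not blue bipartite
  consists of a vertex and two red cliques, and has red cycles of all lengths from 5.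

  If there is a blue triangle but no blue \<open>C\<^sub>5\<close>, then 8 vertices already force a red \<open>C\<^sub>6\<close>. A red
  cycle of length at least 6 with three vertices outside extends by one, or else the cycle and
  the three vertices are covered by two red cliques: each outside vertex has at most two red
  neighbours on the cycle, so that any two have two common blue neighbours there; hence
  the three are pairwise red, and finally each has at most one red neighbour on the cycle.
\<close>

section \<open>Cycles as lists\<close>

text \<open>
  Throughout, \<open>R\<close> is the symmetric relation of being joined in red, and pairs outside \<open>R\<close> count
  as blue; its values on the diagonal do not matter.
\<close>

definition is_cycle :: "('a \<Rightarrow> 'a \<Rightarrow> bool) \<Rightarrow> 'a list \<Rightarrow> bool" where
  "is_cycle R xs \<longleftrightarrow> xs \<noteq> [] \<and> distinct xs \<and> successively R xs \<and> R (last xs) (hd xs)"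

definition has_cycle :: "('a \<Rightarrow> 'a \<Rightarrow> bool) \<Rightarrow> 'a set \<Rightarrow> nat \<Rightarrow> bool" where
  "has_cycle R V k \<longleftrightarrow> (\<exists>xs. is_cycle R xs \<and> set xs \<subseteq> V \<and> length xs = k)"

lemma has_cycleI: "is_cycle R xs \<Longrightarrow> set xs \<subseteq> V \<Longrightarrow> length xs = k \<Longrightarrow> has_cycle R V k"
  by (auto simp: has_cycle_def)

lemma has_cycle_mono: "has_cycle R V k \<Longrightarrow> V \<subseteq> W \<Longrightarrow> has_cycle R W k"
  by (auto simp: has_cycle_def)

text \<open>The successor on the cycle; \<open>nxt (rev xs)\<close> is the predecessor.\<close>

definition nxt :: "'a list \<Rightarrow> 'a \<Rightarrow> 'a" where
  "nxt xs x = hd (tl (dropWhile (\<lambda>y. y \<noteq> x) xs) @ xs)"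

text \<open>The list is read from \<open>x\<close> on and wraps around; the final \<open>[x]\<close>
  matters only when \<open>x\<close> is the sole entry.\<close>

lemma nxt_append:
  assumes "x \<notin> set ys"
  shows "nxt (ys @ x # zs) x = hd (zs @ ys @ [x])"
proof -
  have "dropWhile (\<lambda>y. y \<noteq> x) (ys @ x # zs) = x # zs"
    using assms by (induction ys) auto
  then show ?thesis by (cases zs; cases ys) (simp_all add: nxt_def)
qed

lemma nxt_in_set:
  assumes "x \<in> set xs"
  shows "nxt xs x \<in> set xs"
proof -
  obtain ys zs where "xs = ys @ x # zs" "x \<notin> set ys"
    using split_list_first[OF assms] by blast
  then show ?thesis using nxt_append[of x ys zs] by (cases zs; cases ys) auto
qed

lemma nxt_rotate:
  assumes "distinct (ys @ zs)" "x \<in> set (ys @ zs)"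
  shows "nxt (zs @ ys) x = nxt (ys @ zs) x"
proof (cases "x \<in> set ys")
  case True
  then obtain as bs where ys: "ys = as @ x # bs" by (meson split_list)
  then have "x \<notin> set as" "x \<notin> set (zs @ as)" using assms by auto
  then have "nxt (ys @ zs) x = hd (bs @ zs @ as @ [x])" "nxt (zs @ ys) x = hd (bs @ zs @ as @ [x])"
    using nxt_append[of x as "bs @ zs"] nxt_append[of x "zs @ as" bs] by (simp_all add: ys)
  then show ?thesis by simp
next
  case False
  then have "x \<in> set zs" using assms by simp
  then obtain as bs where zs: "zs = as @ x # bs" by (meson split_list)
  then have "x \<notin> set as" "x \<notin> set (ys @ as)" using assms by auto
  then have "nxt (ys @ zs) x = hd (bs @ ys @ as @ [x])" "nxt (zs @ ys) x = hd (bs @ ys @ as @ [x])"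
    using nxt_append[of x as "bs @ ys"] nxt_append[of x "ys @ as" bs] by (simp_all add: zs)
  then show ?thesis by simp
qed

lemma is_cycle_rotate: "is_cycle R (ys @ zs) \<Longrightarrow> is_cycle R (zs @ ys)"
  by (cases "ys = []"; cases "zs = []")
    (auto simp: is_cycle_def successively_append_iff)

text \<open>Rotation keeps the cycle and all successors, so later arguments may put a chosen vertex
  at the head.\<close>

lemma is_cycle_start:
  assumes "is_cycle R xs" "x \<in> set xs"
  obtains zs where "is_cycle R (x # zs)" "set (x # zs) = set xs" "length (x # zs) = length xs"
    "\<And>y. y \<in> set xs \<Longrightarrow> nxt (x # zs) y = nxt xs y"
proof -
  obtain as bs where xs: "xs = as @ x # bs" using assms(2) by (meson split_list)
  show thesis
  proof (rule that[of "bs @ as"])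
    show "is_cycle R (x # bs @ as)"
      using assms(1) is_cycle_rotate[of R as "x # bs"] by (simp add: xs)
    show "nxt (x # bs @ as) y = nxt xs y" if "y \<in> set xs" for y
      using that assms(1) nxt_rotate[of as "x # bs" y] by (simp add: xs is_cycle_def)
  qed (auto simp: xs)
qed

lemma successively_rev_symp:
  assumes "symp R"
  shows "successively R (rev xs) \<longleftrightarrow> successively R xs"
proof -
  have "successively R (rev xs)" if "successively R xs" for xs
    using that assms by (auto simp: symp_def elim: successively_mono)
  from this[of xs] this[of "rev xs"] show ?thesis by auto
qed

lemma is_cycle_rev:
  assumes "symp R" "is_cycle R xs"
  shows "is_cycle R (rev xs)"
  using assms sympD[OF assms(1)]
  by (auto simp: is_cycle_def hd_rev last_rev successively_rev_symp simp del: successively_rev)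

lemma nxt_nxt_rev:
  assumes "distinct xs" "x \<in> set xs"
  shows "nxt xs (nxt (rev xs) x) = x"
proof -
  obtain as bs where xs: "xs = as @ x # bs" using assms(2) by (meson split_list)
  have r: "nxt (rev xs) x = hd (rev as @ rev bs @ [x])"
    using assms(1) nxt_append[of x "rev bs" "rev as"] by (simp add: xs)
  show ?thesis
  proof (cases as rule: rev_cases)
    case (snoc as' a)
    have "nxt xs a = hd (x # bs @ as' @ [a])"
      using assms(1) nxt_append[of a as' "x # bs"] by (simp add: xs snoc)
    then show ?thesis using r by (simp add: snoc)
  next
    case Nil
    show ?thesis
    proof (cases bs rule: rev_cases)
      case (snoc bs' b)
      have "nxt xs b = x"
        using assms(1) nxt_append[of b "x # bs'" "[]"] by (auto simp: xs snoc Nil)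
      then show ?thesis using r by (simp add: snoc Nil)
    next
      case Nil
      then show ?thesis using r nxt_append[of x "[]" "[]"] by (simp add: xs \<open>as = []\<close>)
    qed
  qed
qed

lemma nxt_rev_nxt: "distinct xs \<Longrightarrow> x \<in> set xs \<Longrightarrow> nxt (rev xs) (nxt xs x) = x"
  using nxt_nxt_rev[of "rev xs" x] by simp

text \<open>Once the list is rotated to start at \<open>x\<close>, the \<open>m\<close>-th iterate
  is entry \<open>m\<close>, and the entries are distinct.\<close>

lemma nxt_funpow_neq:
  assumes "distinct xs" "x \<in> set xs" "0 < n" "n < length xs"
  shows "(nxt xs ^^ n) x \<noteq> x"
proof -
  obtain as bs where xs: "xs = as @ x # bs" using assms(2) by (meson split_list)
  define ys where "ys = x # bs @ as"
  have d: "distinct ys" and l: "length ys = length xs" using assms(1) by (auto simp: xs ys_def)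
  have nx: "nxt xs y = nxt ys y" if "y \<in> set ys" for y
    using that assms(1) nxt_rotate[of as "x # bs" y] by (auto simp: xs ys_def)
  have "(nxt xs ^^ m) x = ys ! m" if "m < length ys" for m
    using that
  proof (induction m)
    case 0
    then show ?case by (simp add: ys_def)
  next
    case (Suc m)
    then have m: "m < length ys" by simp
    have "ys ! m \<notin> set (take m ys)"
      using d m by (metis distinct_take id_take_nth_drop not_distinct_conv_prefix take_Suc_conv_app_nth)
    then have "nxt ys (ys ! m) = hd (drop (Suc m) ys @ take m ys @ [ys ! m])"
      using nxt_append[of "ys ! m" "take m ys" "drop (Suc m) ys"] id_take_nth_drop[OF m] by simp
    also have "\<dots> = ys ! Suc m" using Suc.prems by (simp add: hd_append hd_drop_conv_nth)
    finally show ?case using Suc m by (simp add: nx)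
  qed
  then have "(nxt xs ^^ n) x = ys ! n" using assms l by simp
  moreover have "ys ! n \<noteq> ys ! 0"
    using assms d l by (metis gr0I less_trans nth_eq_iff_index_eq less_numeral_extra(3))
  ultimately show ?thesis by (simp add: ys_def)
qed

section \<open>Three ways to lengthen a cycle by one\<close>

lemma extend_insert:
  assumes "is_cycle R xs" "x \<in> set xs" "v \<notin> set xs" "R x v" "R v (nxt xs x)"
  shows "\<exists>ys. is_cycle R ys \<and> set ys = insert v (set xs) \<and> length ys = Suc (length xs)"
proof -
  obtain zs where zs: "is_cycle R (x # zs)" "set (x # zs) = set xs" "length (x # zs) = length xs"
      "nxt (x # zs) x = nxt xs x"
    using is_cycle_start[OF assms(1,2)] assms(2) by metis
  have "is_cycle R (x # v # zs)"
    using zs assms nxt_append[of x "[]" zs] by (cases zs) (auto simp: is_cycle_def)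
  then show ?thesis using zs by (intro exI[of _ "x # v # zs"]) auto
qed

text \<open>Drop the edges from \<open>x\<close> and \<open>y\<close> to their successors, join
  these successors, and link \<open>x\<close> and \<open>y\<close> through \<open>v\<close>.\<close>

lemma extend_rotation:
  assumes "symp R" "is_cycle R xs" "x \<in> set xs" "y \<in> set xs" "x \<noteq> y" "v \<notin> set xs"
    "R v x" "R v y" "R (nxt xs x) (nxt xs y)"
  shows "\<exists>ys. is_cycle R ys \<and> set ys = insert v (set xs) \<and> length ys = Suc (length xs)"
proof -
  have sym: "\<And>p q. R p q \<Longrightarrow> R q p" using assms(1) by (auto simp: symp_def)
  show ?thesis
  proof (cases "nxt xs x = y \<or> nxt xs y = x")
    \<comment> \<open>For consecutive \<open>x\<close> and \<open>y\<close> an arc would be empty;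
      here \<open>v\<close> fits between them.\<close>
    case True
    then show ?thesis using assms extend_insert[of R xs x v] extend_insert[of R xs y v] sym by metis
  next
    case False
    obtain zs where zs: "is_cycle R (x # zs)" "set (x # zs) = set xs" "length (x # zs) = length xs"
        "\<And>z. z \<in> set xs \<Longrightarrow> nxt (x # zs) z = nxt xs z"
      using is_cycle_start[OF assms(2,3)] by metis
    then have "y \<in> set zs" using assms(4,5) by (metis set_ConsD)
    then obtain as bs where ab: "zs = as @ y # bs" by (meson split_list)
    have d: "distinct (x # as @ y # bs)" using zs(1) by (simp add: ab is_cycle_def)
    have nx: "nxt xs x = hd (as @ [y])"
      using zs(4)[OF assms(3)] nxt_append[of x "[]" zs] by (cases as) (auto simp: ab)
    have ny: "nxt xs y = hd (bs @ [x])"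
      using zs(4)[OF assms(4)] nxt_append[of y "x # as" bs] d by (cases bs) (auto simp: ab)
    have ne: "as \<noteq> []" "bs \<noteq> []" using nx ny False by auto
    have e: "successively R as" "successively R bs" "R (last as) y" "R (last bs) x"
      using zs(1) ne by (auto simp: is_cycle_def ab successively_append_iff successively_Cons)
    have "R (hd bs) (hd as)" "R x (last bs)" "R y v"
      using sym assms(8,9) e(4) nx ny ne by simp_all
    moreover have "v \<notin> set (x # as @ y # bs)" using assms(6) zs(2) ab by simp
    \<comment> \<open>From \<open>v\<close> to \<open>x\<close>, backwards to the successor of
      \<open>y\<close>, across to the successor of \<open>x\<close>, and forwards to
      \<open>y\<close>.\<close>
    ultimately have "is_cycle R (v # x # rev bs @ as @ [y])"
      using d e assms(7) ne unfolding is_cycle_def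
      by (simp add: successively_append_iff successively_Cons hd_rev last_rev
          successively_rev_symp[OF assms(1)] Int_commute del: successively_rev)
    moreover have "set (v # x # rev bs @ as @ [y]) = insert v (set xs)"
      using zs(2) by (auto simp: ab)
    moreover have "length (v # x # rev bs @ as @ [y]) = Suc (length xs)"
      using zs(3) by (simp add: ab)
    ultimately show ?thesis by blast
  qed
qed

text \<open>The path \<open>u\<close>, \<open>v\<close> takes the place of \<open>x\<close>.\<close>

lemma extend_replace:
  assumes "symp R" "is_cycle R xs" "x \<in> set xs" "length xs \<ge> 3" "u \<notin> set xs" "v \<notin> set xs" "u \<noteq> v"
    "R u v" "R u (nxt (rev xs) x)" "R v (nxt xs x)"
  shows "\<exists>ys. is_cycle R ys \<and> set ys \<subseteq> {u, v} \<union> set xs \<and> length ys = Suc (length xs)"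
proof -
  have sym: "\<And>p q. R p q \<Longrightarrow> R q p" using assms(1) by (auto simp: symp_def)
  obtain zs where zs: "is_cycle R (x # zs)" "set (x # zs) = set xs" "length (x # zs) = length xs"
      "\<And>z. z \<in> set xs \<Longrightarrow> nxt (x # zs) z = nxt xs z"
    using is_cycle_start[OF assms(2,3)] by metis
  have ne: "zs \<noteq> []" using zs(3) assms(4) by auto
  have nx: "nxt xs x = hd zs"
    using zs(4)[OF assms(3)] nxt_append[of x "[]" zs] ne by simp
  have "last zs \<in> set xs" "nxt xs (last zs) = x"
  proof -
    show l: "last zs \<in> set xs" using zs(2) ne by (metis last_in_set list.set_intros(2))
    obtain ws w where ws: "zs = ws @ [w]" using ne by (metis rev_exhaust)
    then have "w \<notin> set (x # ws)" using zs(1) by (auto simp: is_cycle_def)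
    then show "nxt xs (last zs) = x"
      using zs(4)[OF l] nxt_append[of w "x # ws" "[]"] by (simp add: ws)
  qed
  then have px: "nxt (rev xs) x = last zs"
    using nxt_rev_nxt[of xs "last zs"] assms(2) by (simp add: is_cycle_def)
  have "is_cycle R (u # v # zs)"
    using zs(1) zs(2)[symmetric] assms(5-8,10) sym[OF assms(9)] ne nx px
    by (auto simp: is_cycle_def successively_Cons)
  moreover have "set (u # v # zs) \<subseteq> {u, v} \<union> set xs" using zs(2) by auto
  moreover have "length (u # v # zs) = Suc (length xs)" using zs(3) by simp
  ultimately show ?thesis by blast
qed

section \<open>No blue triangle\<close>

text \<open>Empty and overlapping cliques are allowed; taking \<open>A\<close> out of
  \<open>B\<close> gives a bipartition of the blue graph.\<close>

definition two_cliques :: "('a \<Rightarrow> 'a \<Rightarrow> bool) \<Rightarrow> 'a set \<Rightarrow> bool" where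
  "two_cliques R V \<longleftrightarrow> (\<exists>A B. A \<union> B = V \<and> pairwise R A \<and> pairwise R B)"

lemma two_cliquesI: "A \<union> B = V \<Longrightarrow> pairwise R A \<Longrightarrow> pairwise R B \<Longrightarrow> two_cliques R V"
  by (auto simp: two_cliques_def)

definition blue_triangle_free :: "('a \<Rightarrow> 'a \<Rightarrow> bool) \<Rightarrow> 'a set \<Rightarrow> bool" where
  "blue_triangle_free R V \<longleftrightarrow>
     (\<forall>x\<in>V. \<forall>y\<in>V. \<forall>z\<in>V. distinct [x, y, z] \<longrightarrow> R x y \<or> R y z \<or> R x z)"

lemma pairwise_imp_successively:
  "pairwise R A \<Longrightarrow> distinct xs \<Longrightarrow> set xs \<subseteq> A \<Longrightarrow> successively R xs"
  by (induction xs rule: induct_list012) (auto simp: pairwise_def)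

lemma is_cycle_join:
  assumes "distinct (as @ bs)" "v \<notin> set (as @ bs)" "successively R as" "successively R bs"
    "as \<noteq> []" "bs \<noteq> []" "R v (hd as)" "R (last as) (hd bs)" "R (last bs) v"
  shows "is_cycle R (v # as @ bs)"
  using assms by (auto simp: is_cycle_def successively_append_iff successively_Cons)

text \<open>However \<open>W\<close> is covered by two red cliques, \<open>v\<close> has neighbours
  of both colours in each. Its blue neighbours \<open>x\<close> and \<open>y\<close> are red to each
  other, so \<open>v\<close>, \<open>a\<close>, ..., \<open>x\<close>, \<open>y\<close>, ...,
  \<open>b\<close> is a red cycle whose two gaps take any further vertices of the respective
  clique.\<close>

lemma near_two_cliques_cycles:
  assumes "symp R" "finite W" "v \<notin> W" "blue_triangle_free R (insert v W)"
    "two_cliques R W" "\<not> two_cliques R (insert v W)"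
  shows "4 \<le> card W" "5 \<le> k \<Longrightarrow> k \<le> Suc (card W) \<Longrightarrow> has_cycle R (insert v W) k"
proof -
  have sym: "\<And>p q. R p q \<longleftrightarrow> R q p" using assms(1) by (auto simp: symp_def)
  obtain A B' where "A \<union> B' = W" and A: "pairwise R A" and B': "pairwise R B'"
    using assms(5) by (auto simp: two_cliques_def)
  define B where "B = B' - A"
  have W: "A \<union> B = W" and disj: "A \<inter> B = {}" and B: "pairwise R B"
    using \<open>A \<union> B' = W\<close> B' by (auto simp: B_def pairwise_def)
  have red: "R p q" if "p \<in> W" "q \<in> W" "p \<noteq> q" "\<not> R v p" "\<not> R v q" for p q
    using assms(4)[unfolded blue_triangle_free_def, rule_format, of p v q] assms(3) that
    by (auto simp: sym[of p v])
  have ins: "pairwise R (insert v S)" if "pairwise R S" "\<forall>s\<in>S. R v s" for S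
    using that sym unfolding pairwise_def by blast
  \<comment> \<open>If \<open>v\<close> is red to all of \<open>P\<close>, it joins
    \<open>P\<close>. If it is blue to all of \<open>P\<close>, its blue neighbours in
    \<open>Q\<close> join \<open>P\<close>, since blue neighbours of \<open>v\<close> are pairwise
    red, and \<open>v\<close> joins the rest of \<open>Q\<close>.\<close>
  have *: "(\<exists>p\<in>P. \<not> R v p) \<and> (\<exists>p\<in>P. R v p)"
    if PQ: "P \<union> Q = W" "pairwise R P" "pairwise R Q" for P Q
  proof (rule ccontr)
    assume "\<not> ?thesis"
    then consider "\<forall>p\<in>P. R v p" | "\<forall>p\<in>P. \<not> R v p" by blast
    then show False
    proof cases
      case 1
      then show False
        using assms(6) two_cliquesI[of "insert v P" Q "insert v W" R] ins[OF PQ(2)] PQ by auto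
    next
      case 2
      have "pairwise R (P \<union> {q\<in>Q. \<not> R v q})"
        using 2 PQ red by (auto simp: pairwise_def)
      moreover have "pairwise R (insert v {q\<in>Q. R v q})"
        using PQ(3) by (intro ins) (auto simp: pairwise_def)
      ultimately show False
        using assms(6) PQ(1) two_cliquesI[of "P \<union> {q\<in>Q. \<not> R v q}" "insert v {q\<in>Q. R v q}" "insert v W" R]
        by blast
    qed
  qed
  obtain x a where xa: "x \<in> A" "\<not> R v x" "a \<in> A" "R v a" using *[OF W A B] by blast
  obtain y b where yb: "y \<in> B" "\<not> R v y" "b \<in> B" "R v b" using *[of B A] W A B by blast
  have S: "{a, x, y, b} \<subseteq> W" and c: "card {a, x, y, b} = 4"
    using xa yb W disj by (auto simp: card_insert_if)
  then show "4 \<le> card W" using card_mono[OF assms(2)] by metis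
  show "has_cycle R (insert v W) k" if k: "5 \<le> k" "k \<le> Suc (card W)"
  proof -
    \<comment> \<open>Five vertices of the cycle are fixed; the others are arbitrary
      fillers.\<close>
    have "k - 5 \<le> card (W - {a, x, y, b})"
      using k c S assms(2) by (simp add: card_Diff_subset)
    then obtain U where U: "U \<subseteq> W - {a, x, y, b}" "card U = k - 5" by (meson obtain_subset_with_card_n)
    then have "finite U" using assms(2) by (meson finite_Diff finite_subset)
    then obtain l where l: "set l = U" "distinct l" using finite_distinct_list by blast
    let ?la = "filter (\<lambda>u. u \<in> A) l" and ?lb = "filter (\<lambda>u. u \<notin> A) l"
    have da: "distinct (a # ?la @ [x])" and sa: "set (a # ?la @ [x]) \<subseteq> A"
      using U xa l by auto
    have db: "distinct (y # ?lb @ [b])" and sb: "set (y # ?lb @ [b]) \<subseteq> B"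
      using U yb l W by auto
    have "distinct ((a # ?la @ [x]) @ (y # ?lb @ [b]))"
      using da db sa sb disj unfolding distinct_append by blast
    moreover have "R x y" using red xa yb disj W by blast
    moreover have "v \<notin> set ((a # ?la @ [x]) @ (y # ?lb @ [b]))"
      using assms(3) W sa sb by (metis Un_mono set_append subsetD)
    moreover have "successively R (a # ?la @ [x])" "successively R (y # ?lb @ [b])"
      using pairwise_imp_successively[OF A da sa] pairwise_imp_successively[OF B db sb] by blast+
    moreover have "R b v" "R v a" using xa yb sym by blast+
    ultimately have "is_cycle R (v # (a # ?la @ [x]) @ (y # ?lb @ [b]))"
      by (intro is_cycle_join) auto
    moreover have "length (v # (a # ?la @ [x]) @ (y # ?lb @ [b])) = k"
      using sum_length_filter_compl[of "\<lambda>u. u \<in> A" l] distinct_card[OF l(2)] l(1) U(2) k by simp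
    ultimately show ?thesis
      using has_cycleI sa sb W by (metis Un_mono insert_mono list.simps(15) set_append)
  qed
qed

text \<open>If \<open>v\<close> has at most one red neighbour, the two form a red clique, and so do
  the blue neighbours of \<open>v\<close>. Given two red neighbours, either \<open>v\<close> fits in
  after one of them, or both successors are blue to \<open>v\<close>, hence red to each other, and
  rotation applies.\<close>

lemma insert_vertex_or_two_cliques:
  assumes "symp R" "v \<notin> set xs" "is_cycle R xs" "blue_triangle_free R (insert v (set xs))"
    "\<not> two_cliques R (insert v (set xs))"
  shows "\<exists>ys. is_cycle R ys \<and> set ys = insert v (set xs) \<and> length ys = Suc (length xs)"
proof -
  have sym: "\<And>p q. R p q \<longleftrightarrow> R q p" using assms(1) by (auto simp: symp_def)
  have red: "R p q" if "p \<in> set xs" "q \<in> set xs" "p \<noteq> q" "\<not> R v p" "\<not> R v q" for p q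
    using assms(4)[unfolded blue_triangle_free_def, rule_format, of p v q] assms(2) that
    by (auto simp: sym[of p v])
  define N where "N = {x \<in> set xs. R v x}"
  have "pairwise R (set xs - N)" using red by (auto simp: pairwise_def N_def)
  moreover have "insert v N \<union> (set xs - N) = insert v (set xs)" by (auto simp: N_def)
  ultimately have "\<not> pairwise R (insert v N)"
    using assms(5) two_cliquesI[of "insert v N" "set xs - N" "insert v (set xs)" R] by blast
  then obtain x y where xy: "x \<in> N" "y \<in> N" "x \<noteq> y"
    using sym unfolding pairwise_def N_def by blast
  have d: "distinct xs" using assms(3) by (simp add: is_cycle_def)
  show ?thesis
  proof (cases "R v (nxt xs x) \<or> R v (nxt xs y)")
    case True
    then show ?thesis
      using extend_insert[OF assms(3) _ assms(2)] xy sym[of _ v] unfolding N_def by blast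
  next
    case False
    have "x \<in> set xs" "y \<in> set xs" using xy by (auto simp: N_def)
    then have "nxt xs x \<noteq> nxt xs y"
      using nxt_rev_nxt[OF d] xy(3) by metis
    then have "R (nxt xs x) (nxt xs y)"
      using False \<open>x \<in> set xs\<close> \<open>y \<in> set xs\<close> by (intro red nxt_in_set) auto
    then show ?thesis
      using extend_rotation[OF assms(1,3) _ _ xy(3) assms(2)] xy by (auto simp: N_def)
  qed
qed

text \<open>Induction on the order: vertices are deleted until every further deletion leaves two red
  cliques, which is the case of \<open>near_two_cliques_cycles\<close>. Each vertex put back extends
  a spanning cycle and so adds one length.\<close>

theorem triangle_free_cycles:
  assumes "symp R" "finite V" "blue_triangle_free R V" "\<not> two_cliques R V"
  shows "5 \<le> card V" "5 \<le> k \<Longrightarrow> k \<le> card V \<Longrightarrow> has_cycle R V k"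
proof -
  have "5 \<le> card V \<and> (\<forall>k. 5 \<le> k \<and> k \<le> card V \<longrightarrow> has_cycle R V k)"
    using assms(2-)
  proof (induction "card V" arbitrary: V)
    case 0
    then show ?case by (auto simp: two_cliques_def)
  next
    case (Suc n)
    show ?case
    proof (cases "\<exists>v\<in>V. \<not> two_cliques R (V - {v})")
      case True
      then obtain v where v: "v \<in> V" "\<not> two_cliques R (V - {v})" by blast
      then have n: "n = card (V - {v})" using Suc.hyps(2) by simp
      have "blue_triangle_free R (V - {v})"
        using Suc.prems(2) by (auto simp: blue_triangle_free_def)
      then have IH: "5 \<le> n" "\<And>k. 5 \<le> k \<Longrightarrow> k \<le> n \<Longrightarrow> has_cycle R (V - {v}) k"
        using Suc.hyps(1)[OF n] Suc.prems(1) v(2) n by auto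
      have "has_cycle R V (Suc n)"
      proof -
        obtain xs where xs: "is_cycle R xs" "set xs \<subseteq> V - {v}" "length xs = n"
          using IH by (auto simp: has_cycle_def)
        have "card (set xs) = n" using xs by (simp add: is_cycle_def distinct_card)
        then have "set xs = V - {v}"
          using xs(2) n Suc.prems(1) by (metis card_subset_eq finite_Diff)
        then have V: "insert v (set xs) = V" "v \<notin> set xs" using v by auto
        show ?thesis
          using insert_vertex_or_two_cliques[OF assms(1) V(2) xs(1)] Suc.prems V(1) xs(3)
          by (auto simp: has_cycle_def)
      qed
      then show ?thesis
        using IH Suc.hyps(2) by (metis Diff_subset has_cycle_mono le_SucE le_SucI)
    next
      case False
      obtain v where v: "v \<in> V" using Suc.hyps(2) by (metis card_eq_SucD insertI1)
      then have V: "insert v (V - {v}) = V" "Suc (card (V - {v})) = card V"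
        using Suc.prems(1) Suc.hyps(2) by auto
      then show ?thesis
        using near_two_cliques_cycles[OF assms(1), of "V - {v}" v] Suc.prems False v
        by (metis Diff_iff Suc_le_mono eval_nat_numeral(3) finite_Diff insertI1)
    qed
  qed
  then show "5 \<le> card V" "5 \<le> k \<Longrightarrow> k \<le> card V \<Longrightarrow> has_cycle R V k" by auto
qed

section \<open>Red hexagons\<close>

definition blue_pentagon_free :: "('a \<Rightarrow> 'a \<Rightarrow> bool) \<Rightarrow> 'a set \<Rightarrow> bool" where
  "blue_pentagon_free R V \<longleftrightarrow>
     (\<forall>p\<in>V. \<forall>q\<in>V. \<forall>r\<in>V. \<forall>s\<in>V. \<forall>t\<in>V. distinct [p, q, r, s, t] \<longrightarrow>
        R p q \<or> R q r \<or> R r s \<or> R s t \<or> R t p)"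

lemma blue_pentagonE:
  assumes "blue_pentagon_free R V" "\<not> R p q" "\<not> R q r" "\<not> R r s" "\<not> R s t" "\<not> R t p"
    "distinct [p, q, r, s, t]" "{p, q, r, s, t} \<subseteq> V"
  shows False
  using assms unfolding blue_pentagon_free_def by blast

lemma hexagonI:
  assumes "R a b" "R b c" "R c d" "R d e" "R e f" "R f a"
    "distinct [a, b, c, d, e, f]" "{a, b, c, d, e, f} \<subseteq> V"
  shows "has_cycle R V 6"
  using assms by (intro has_cycleI[of R "[a, b, c, d, e, f]"]) (simp_all add: is_cycle_def)

text \<open>\<open>K\<^sub>3\<^sub>,\<^sub>3\<close> minus a matching contains a hexagon.\<close>

lemma alternating_hexagon:
  assumes "symp R" "distinct [s, t, u, x, y, z]" "{s, t, u, x, y, z} \<subseteq> V"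
    and "\<And>p. p \<in> {s, t, u} \<Longrightarrow> (R p x \<or> R p y) \<and> (R p x \<or> R p z) \<and> (R p y \<or> R p z)"
    and "\<And>q. q \<in> {x, y, z} \<Longrightarrow> (R s q \<or> R t q) \<and> (R s q \<or> R u q) \<and> (R t q \<or> R u q)"
  shows "has_cycle R V 6"
proof (rule ccontr)
  assume "\<not> ?thesis"
  moreover have "has_cycle R V 6" if "p1 \<in> {s, t, u}" "p2 \<in> {s, t, u}" "p3 \<in> {s, t, u}"
      "distinct [p1, p2, p3]" "R p1 x" "R p2 x" "R p2 y" "R p3 y" "R p3 z" "R p1 z" for p1 p2 p3
    using that assms(2,3) sympD[OF assms(1)] by (intro hexagonI[of R p1 x p2 y p3 z]) auto
  ultimately have *: "\<not> (R p1 x \<and> R p2 x \<and> R p2 y \<and> R p3 y \<and> R p3 z \<and> R p1 z)"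
    if "p1 \<in> {s, t, u}" "p2 \<in> {s, t, u}" "p3 \<in> {s, t, u}" "distinct [p1, p2, p3]" for p1 p2 p3
    using that by blast
  have "s \<noteq> t" "s \<noteq> u" "t \<noteq> u" using assms(2) by auto
  \<comment> \<open>A hexagon of the complete bipartite graph misses a perfect matching, and the six
    orders of \<open>s\<close>, \<open>t\<close>, \<open>u\<close> give all of these. The blue edges
    form a matching, so some hexagon avoids them.\<close>
  then show False
    using *[of s t u] *[of s u t] *[of t s u] *[of t u s] *[of u s t] *[of u t s]
      assms(4)[of s] assms(4)[of t] assms(4)[of u] assms(5)[of x] assms(5)[of y] assms(5)[of z]
    by (simp only: distinct.simps list.set insert_iff empty_iff simp_thms) argo
qed

text \<open>If two vertices of \<open>S\<close> share a blue neighbour in \<open>Q\<close>, they are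
  red to the other three, and any third vertex of \<open>S\<close> completes an alternating hexagon.
  Otherwise the blue edges between \<open>S\<close> and \<open>Q\<close> form a matching, and any
  three vertices on each side will do.\<close>

lemma hexagon_4_3:
  assumes "symp R" "Q \<subseteq> V" "S \<subseteq> V" "Q \<inter> S = {}" "card Q = 4" "3 \<le> card S"
    and few: "\<And>s q q'. s \<in> S \<Longrightarrow> q \<in> Q \<Longrightarrow> q' \<in> Q \<Longrightarrow> q \<noteq> q' \<Longrightarrow> R s q \<or> R s q'"
  shows "has_cycle R V 6"
proof (cases "\<exists>q\<in>Q. \<exists>s\<in>S. \<exists>t\<in>S. s \<noteq> t \<and> \<not> R s q \<and> \<not> R t q")
  case True
  then obtain q s t where q: "q \<in> Q" "s \<in> S" "t \<in> S" "s \<noteq> t" "\<not> R s q" "\<not> R t q" by blast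
  have "card (Q - {q}) = 3" using assms(5) q(1) by simp
  then obtain x y z where xyz: "Q - {q} = {x, y, z}" "distinct [x, y, z]"
    by (auto simp: card_3_iff)
  have "\<not> S \<subseteq> {s, t}"
    using assms(6) card_mono[of "{s, t}" S] q(4) by auto
  then obtain u where u: "u \<in> S" "u \<noteq> s" "u \<noteq> t" by blast
  have mem: "x \<in> Q" "y \<in> Q" "z \<in> Q" "x \<noteq> q" "y \<noteq> q" "z \<noteq> q" using xyz by blast+
  then have "R p x \<and> R p y \<and> R p z" if "p \<in> {s, t}" for p
    using that q few by blast
  then show ?thesis
    using few[OF u(1)] mem xyz(2) q u assms(2-4)
    by (intro alternating_hexagon[OF assms(1), of s t u x y z]) auto
next
  case False
  obtain S' where S': "S' \<subseteq> S" "card S' = 3" using assms(6) by (meson obtain_subset_with_card_n)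
  then obtain s t u where stu: "S' = {s, t, u}" "distinct [s, t, u]" by (auto simp: card_3_iff)
  obtain Q' where Q': "Q' \<subseteq> Q" "card Q' = 3"
    using assms(5) obtain_subset_with_card_n[of 3 Q] by auto
  then obtain x y z where xyz: "Q' = {x, y, z}" "distinct [x, y, z]" by (auto simp: card_3_iff)
  have S: "s \<in> S" "t \<in> S" "u \<in> S" using S'(1) stu(1) by auto
  have Q: "x \<in> Q" "y \<in> Q" "z \<in> Q" using Q'(1) xyz(1) by auto
  show ?thesis
  proof (rule alternating_hexagon[OF assms(1)])
    show "distinct [s, t, u, x, y, z]" using stu(2) xyz(2) S Q assms(4) by auto
    show "{s, t, u, x, y, z} \<subseteq> V" using S Q assms(2,3) by auto
    show "(R p x \<or> R p y) \<and> (R p x \<or> R p z) \<and> (R p y \<or> R p z)" if "p \<in> {s, t, u}" for p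
    proof -
      have "p \<in> S" using that S by blast
      then show ?thesis using few Q xyz(2) by auto
    qed
    show "(R s q \<or> R t q) \<and> (R s q \<or> R u q) \<and> (R t q \<or> R u q)" if "q \<in> {x, y, z}" for q
    proof -
      have "q \<in> Q" using that Q by blast
      then show ?thesis using False S stu(2) by auto
    qed
  qed
qed

text \<open>Otherwise \<open>s\<close> would close the blue path from \<open>p\<close> through the
  other two vertices to \<open>q\<close> to a pentagon.\<close>

lemma blue_K4_few:
  assumes "symp R" "blue_pentagon_free R V" "{a, b, c, d, s} \<subseteq> V" "distinct [a, b, c, d, s]"
    "\<not> R a b" "\<not> R a c" "\<not> R a d" "\<not> R b c" "\<not> R b d" "\<not> R c d"
    "p \<in> {a, b, c, d}" "q \<in> {a, b, c, d}" "p \<noteq> q"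
  shows "R s p \<or> R s q"
proof -
  obtain r r' where r: "{r, r'} \<subseteq> {a, b, c, d} - {p, q}" "r \<noteq> r'"
    using assms(4,11-13) by (cases "p = a"; cases "p = b"; cases "p = c"; cases "q = a"; cases "q = b"; cases "q = c") auto
  have blue: "\<not> R x y" if "x \<in> {a, b, c, d}" "y \<in> {a, b, c, d}" "x \<noteq> y" for x y
    using that assms(5-10) sympD[OF assms(1)] by blast
  show ?thesis
  proof (rule ccontr)
    assume "\<not> ?thesis"
    moreover have "\<not> R q s" if "\<not> R s q" using that sympD[OF assms(1)] by blast
    moreover have "\<not> R p r" "\<not> R r r'" "\<not> R r' q" using blue r assms(11-13) by auto
    moreover have "distinct [s, p, r, r', q]" using r assms(4,11-13) by auto
    moreover have "{s, p, r, r', q} \<subseteq> V" using r assms(3,11-13) by auto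
    ultimately show False using blue_pentagonE[OF assms(2), of s p r r' q] by blast
  qed
qed

lemma hexagon_blue_K4:
  assumes "symp R" "blue_pentagon_free R V" "8 \<le> card V"
    "{a, b, c, d} \<subseteq> V" "distinct [a, b, c, d]"
    "\<not> R a b" "\<not> R a c" "\<not> R a d" "\<not> R b c" "\<not> R b d" "\<not> R c d"
  shows "has_cycle R V 6"
proof (rule hexagon_4_3[OF assms(1)])
  show "card {a, b, c, d} = 4" using assms(5) by simp
  then show "3 \<le> card (V - {a, b, c, d})"
    using assms(3,4) by (subst card_Diff_subset) auto
  show "R s p \<or> R s q"
    if "s \<in> V - {a, b, c, d}" "p \<in> {a, b, c, d}" "q \<in> {a, b, c, d}" "p \<noteq> q" for s p q
    using that assms(4-) by (intro blue_K4_few[OF assms(1,2), of a b c d s p q]) auto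
qed (use assms(4) in auto)

text \<open>The assumed blue edges form a \<open>K\<^sub>4\<close> minus the edge
  \<open>c d\<close>. From \<open>c\<close>, blue paths through all four vertices lead to each of
  \<open>a\<close>, \<open>b\<close> and \<open>d\<close>, and \<open>s\<close> would close one to a
  pentagon.\<close>

lemma diamond_few:
  assumes "symp R" "blue_pentagon_free R V" "{a, b, c, d, s} \<subseteq> V" "distinct [a, b, c, d, s]"
    "\<not> R a b" "\<not> R a c" "\<not> R b c" "\<not> R a d" "\<not> R b d" "\<not> R s c"
  shows "R s a" "R s b" "R s d"
proof -
  have sym: "\<And>p q. \<not> R p q \<Longrightarrow> \<not> R q p" using assms(1) by (auto simp: symp_def)
  have ne: "distinct [s, c, b, d, a]" "distinct [s, c, a, d, b]" "distinct [s, c, a, b, d]"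
    using assms(4) by auto
  show "R s a" "R s b" "R s d"
    using blue_pentagonE[OF assms(2) _ _ _ _ _ ne(1)] blue_pentagonE[OF assms(2) _ _ _ _ _ ne(2)]
      blue_pentagonE[OF assms(2) _ _ _ _ _ ne(3)] assms(3,5-) sym by blast+
qed

text \<open>Unless \<open>hexagon_4_3\<close> applies, some outside vertex \<open>e\<close> has two
  blue neighbours in the diamond. These must be \<open>a\<close> and \<open>b\<close>, so the spine
  \<open>a b\<close> has three blue pages \<open>c\<close>, \<open>d\<close>, \<open>e\<close>. Blue
  edges from the pages to three further vertices form a matching.\<close>

lemma hexagon_blue_diamond:
  assumes "symp R" "blue_pentagon_free R V" "8 \<le> card V"
    "{a, b, c, d} \<subseteq> V" "distinct [a, b, c, d]"
    "\<not> R a b" "\<not> R a c" "\<not> R b c" "\<not> R a d" "\<not> R b d"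
  shows "has_cycle R V 6"
proof (rule ccontr)
  assume no: "\<not> has_cycle R V 6"
  have sym: "\<And>p q. R p q \<Longrightarrow> R q p" using assms(1) by (auto simp: symp_def)
  \<comment> \<open>Two pages joined in blue would form a blue \<open>K\<^sub>4\<close> with the
    spine.\<close>
  have pages: "R x y" if "\<not> R a x" "\<not> R b x" "\<not> R a y" "\<not> R b y" "distinct [a, b, x, y]"
    "{x, y} \<subseteq> V" for x y
    using that hexagon_blue_K4[OF assms(1-3), of a b x y] no assms(4,6) by auto
  have few: "R s a" "R s b" "R s y" if "\<not> R a x" "\<not> R b x" "\<not> R a y" "\<not> R b y"
    "distinct [a, b, x, y, s]" "{x, y, s} \<subseteq> V" "\<not> R s x" for x y s
    using diamond_few[OF assms(1,2), of a b x y s] that assms(4,6) by auto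
  have "\<exists>e\<in>V - {a, b, c, d}. \<exists>p\<in>{a, b, c, d}. \<exists>q\<in>{a, b, c, d}. p \<noteq> q \<and> \<not> R e p \<and> \<not> R e q"
  proof (rule ccontr)
    assume none: "\<not> ?thesis"
    have "card {a, b, c, d} = 4" using assms(5) by simp
    moreover from this have "3 \<le> card (V - {a, b, c, d})"
      using assms(3,4) by (subst card_Diff_subset) auto
    ultimately show False
      using hexagon_4_3[OF assms(1,4), of "V - {a, b, c, d}"] none no by auto
  qed
  then obtain e p q where e: "e \<in> V" "e \<notin> {a, b, c, d}" "p \<in> {a, b, c, d}" "q \<in> {a, b, c, d}"
      "p \<noteq> q" "\<not> R e p" "\<not> R e q" by blast
  have dist: "distinct [a, b, c, d, e]" "distinct [a, b, d, c, e]" using assms(5) e(2) by auto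
  have mem: "a \<in> V" "b \<in> V" "c \<in> V" "d \<in> V" using assms(4) by auto
  \<comment> \<open>If \<open>e\<close> were blue to \<open>c\<close> or \<open>d\<close>, it would
    be red to the other three vertices of the diamond.\<close>
  have "R e c \<or> R e a \<and> R e b \<and> R e d" "R e d \<or> R e a \<and> R e b \<and> R e c"
    using few[OF assms(7,8,9,10) dist(1)] few[OF assms(9,10,7,8) dist(2)] e(1) mem by blast+
  then have "\<not> R e a" "\<not> R e b" using e(3-) by blast+
  then have ea: "\<not> R a e" "\<not> R b e" using sym by blast+
  define S where "S = V - {a, b, c, d, e}"
  have "3 \<le> card S"
    using assms(3) mem e(1) dist(1) unfolding S_def by (subst card_Diff_subset) auto
  then obtain S' where "S' \<subseteq> S" "card S' = 3" by (meson obtain_subset_with_card_n)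
  then obtain t u v where tuv: "distinct [t, u, v]" "{t, u, v} \<subseteq> S" by (auto simp: card_3_iff)
  have blue: "\<not> R a x" "\<not> R b x" "x \<in> V" "x \<noteq> a" "x \<noteq> b" if "x \<in> {c, d, e}" for x
    using that assms(7-10) ea mem e(1) dist by auto
  have page: "R x y" if "x \<in> {c, d, e}" "y \<in> {c, d, e}" "x \<noteq> y" for x y
    using pages blue that dist by auto
  have few': "R s a" "R s b" "R s y"
    if "x \<in> {c, d, e}" "y \<in> {c, d, e}" "x \<noteq> y" "s \<in> S" "\<not> R s x" for x y s
    using few[of x y s] blue that dist unfolding S_def by auto
  \<comment> \<open>Two vertices blue to the page \<open>x\<close> are red to the spine and to the
    other pages, so \<open>y s a s' z x\<close> would be a red hexagon.\<close>
  have shared: "R s x \<or> R s' x"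
    if that': "x \<in> {c, d, e}" "s \<in> S" "s' \<in> S" "s \<noteq> s'" for s s' x
  proof (rule ccontr)
    assume "\<not> ?thesis"
    then have n: "\<not> R s x" "\<not> R s' x" by blast+
    have "\<exists>y\<in>{c, d, e}. \<exists>z\<in>{c, d, e}. x \<noteq> y \<and> x \<noteq> z \<and> y \<noteq> z"
      using that(1) dist by auto
    then obtain y z where xyz: "x \<in> {c, d, e}" "y \<in> {c, d, e}" "z \<in> {c, d, e}"
        "x \<noteq> y" "x \<noteq> z" "y \<noteq> z"
      using that' by blast
    have "R y s" "R a s'" by (rule sym, rule few'[OF xyz(1,2,4)], fact+)+
    moreover have "R s a" "R s' z" by (rule few'[OF xyz(1,3,5)], fact+)+
    moreover have "R z x" "R x y" using page xyz by blast+
    moreover have "distinct [y, s, a, s', z, x]" "{y, s, a, s', z, x} \<subseteq> V"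
      using that(2-4) xyz blue mem
      unfolding S_def by auto
    ultimately show False using hexagonI[of R y s a s' z x V] no by blast
  qed
  have "has_cycle R V 6"
  proof (rule alternating_hexagon[OF assms(1)])
    show "distinct [t, u, v, c, d, e]" using tuv dist by (auto simp: S_def)
    show "{t, u, v, c, d, e} \<subseteq> V" using tuv(2) mem e(1) by (auto simp: S_def)
    show "(R p c \<or> R p d) \<and> (R p c \<or> R p e) \<and> (R p d \<or> R p e)" if "p \<in> {t, u, v}" for p
    proof -
      have "p \<in> S" using that tuv(2) by blast
      moreover have "c \<noteq> d" "c \<noteq> e" "d \<noteq> e" using dist by auto
      ultimately show ?thesis
        using few'(3)[of c d p] few'(3)[of c e p] few'(3)[of d e p] by blast
    qed
    show "(R t q \<or> R u q) \<and> (R t q \<or> R v q) \<and> (R u q \<or> R v q)" if "q \<in> {c, d, e}" for q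
      using shared[OF that] tuv by auto
  qed
  then show False using no by blast
qed

text \<open>Among the four leaves there is no blue path on four vertices, which \<open>p\<close>
  would close to a pentagon, and no red path on three, which \<open>q\<close>, the fourth leaf and
  \<open>r\<close> would close to a hexagon. But if red edges form a matching, a blue path on all
  four exists.\<close>

lemma hexagon_blue_star:
  assumes "symp R" "blue_pentagon_free R V" "distinct [p, q, r, u1, u2, u3, u4]"
    "{p, q, r, u1, u2, u3, u4} \<subseteq> V"
    and star: "\<And>u. u \<in> {u1, u2, u3, u4} \<Longrightarrow> \<not> R u p \<and> R u q \<and> R u r"
  shows "has_cycle R V 6"
proof (rule ccontr)
  assume no: "\<not> has_cycle R V 6"
  have sym: "\<And>x y. R x y \<longleftrightarrow> R y x" by (meson assms(1) sympD)
  define P where "P i j k l \<longleftrightarrow> distinct [i, j, k, l] \<and> {i, j, k, l} \<subseteq> {u1, u2, u3, u4}" for i j k l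
  have pent: "R i j \<or> R j k \<or> R k l" if "P i j k l" for i j k l
  proof (rule ccontr)
    assume "\<not> ?thesis"
    moreover have "\<not> R p i" "\<not> R l p" using that star[of i] star[of l] sym[of p i] unfolding P_def by blast+
    moreover have "distinct [p, i, j, k, l]" "{p, i, j, k, l} \<subseteq> V"
      using that assms(3,4) unfolding P_def by auto
    ultimately show False using blue_pentagonE[OF assms(2), of p i j k l] by blast
  qed
  have hex: "\<not> (R i j \<and> R j k)" if "P i j k l" for i j k l
  proof
    assume "R i j \<and> R j k"
    moreover have "R k q" "R q l" "R l r" "R r i"
      using that star[of i] star[of k] star[of l] sym[of q l] sym[of r i] unfolding P_def by blast+
    moreover have "distinct [i, j, k, q, l, r]" "{i, j, k, q, l, r} \<subseteq> V"
      using that assms(3,4) unfolding P_def by auto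
    ultimately show False using hexagonI[of R i j k q l r V] no by blast
  qed
  \<comment> \<open>A red edge \<open>i j\<close> would make \<open>i k\<close>, \<open>k j\<close>
    and \<open>j l\<close> blue, a forbidden path.\<close>
  have blue: "\<not> R i j" if "P i j k l" for i j k l
  proof
    assume "R i j"
    moreover have "P k i j l" "P i j k l" "P i j l k" "P i k j l"
      using that by (auto simp: P_def)
    ultimately show False using hex[of k i j l] hex[of i j k l] hex[of i j l k] pent[of i k j l] sym[of k i] sym[of k j]
      by blast
  qed
  have "P u1 u2 u3 u4" "P u2 u3 u1 u4" "P u3 u4 u1 u2" using assms(3) by (auto simp: P_def)
  then show False using blue pent by blast
qed

text \<open>An outside vertex has at most one blue neighbour in the triangle \<open>T\<close>, and
  among any three outside vertices two share theirs. Five outside vertices then yield four with the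
  same blue neighbour \<open>p\<close>, the configuration of
  \<open>hexagon_blue_star\<close>.\<close>

theorem hexagon_blue_triangle:
  assumes "symp R" "blue_pentagon_free R V" "8 \<le> card V"
    "{a, b, c} \<subseteq> V" "distinct [a, b, c]" "\<not> R a b" "\<not> R b c" "\<not> R a c"
  shows "has_cycle R V 6"
proof (rule ccontr)
  assume no: "\<not> has_cycle R V 6"
  have sym: "\<And>x y. R x y \<longleftrightarrow> R y x" by (meson assms(1) sympD)
  define T where "T = {a, b, c}"
  define S where "S = V - T"
  have T: "T \<subseteq> V" "card T = 3" using assms(4,5) by (auto simp: T_def)
  have blue: "\<not> R p q" if "p \<in> T" "q \<in> T" "p \<noteq> q" for p q
    using that assms(6-8) sym[of a b] sym[of b c] sym[of a c] unfolding T_def by blast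
  have third: "\<exists>r\<in>T. r \<noteq> p \<and> r \<noteq> q" for p q
    using assms(5) unfolding T_def by auto
  \<comment> \<open>Two blue neighbours in \<open>T\<close> would give a blue diamond.\<close>
  have few: "R s p \<or> R s q" if "s \<in> S" "p \<in> T" "q \<in> T" "p \<noteq> q" for s p q
  proof (rule ccontr)
    assume n: "\<not> ?thesis"
    obtain r where r: "r \<in> T" "r \<noteq> p" "r \<noteq> q" using third by blast
    have "\<not> R p q" "\<not> R p r" "\<not> R q r" using blue that r by auto
    moreover have "\<not> R p s" "\<not> R q s" using n sym[of p s] sym[of q s] by blast+
    moreover have "{p, q, r, s} \<subseteq> V" "distinct [p, q, r, s]" using that r T(1) by (auto simp: S_def)
    ultimately show False using hexagon_blue_diamond[OF assms(1-3), of p q r s] no by blast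
  qed
  \<comment> \<open>Otherwise the blue edges to \<open>T\<close> would form a matching.\<close>
  have share: "\<exists>p\<in>T. \<not> R t p \<and> \<not> R u p \<or> \<not> R t p \<and> \<not> R v p \<or> \<not> R u p \<and> \<not> R v p"
    if "t \<in> S" "u \<in> S" "v \<in> S" "distinct [t, u, v]" for t u v
  proof (rule ccontr)
    assume n: "\<not> ?thesis"
    have "has_cycle R V 6"
    proof (rule alternating_hexagon[OF assms(1)])
      show "distinct [t, u, v, a, b, c]" using that assms(5) by (auto simp: S_def T_def)
      show "{t, u, v, a, b, c} \<subseteq> V" using that assms(4) by (auto simp: S_def)
      show "(R p a \<or> R p b) \<and> (R p a \<or> R p c) \<and> (R p b \<or> R p c)" if "p \<in> {t, u, v}" for p
      proof -
        have "p \<in> S" using that \<open>t \<in> S\<close> \<open>u \<in> S\<close> \<open>v \<in> S\<close> by blast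
        then show ?thesis using few assms(5) by (auto simp: T_def)
      qed
      show "(R t q \<or> R u q) \<and> (R t q \<or> R v q) \<and> (R u q \<or> R v q)" if "q \<in> {a, b, c}" for q
        using n that unfolding T_def by blast
    qed
    then show False using no by blast
  qed
  have "finite T" by (simp add: T_def)
  then have S: "5 \<le> card S" using assms(3) T by (simp add: S_def card_Diff_subset)
  have more: "\<exists>W\<subseteq>S. W \<inter> U = {} \<and> card W = n" if "finite U" "card U + n \<le> 5" for U n
  proof -
    have "n \<le> card (S - U)" using S that diff_card_le_card_Diff[OF that(1), of S] by linarith
    then obtain W where "W \<subseteq> S - U" "card W = n" by (rule obtain_subset_with_card_n)
    then show ?thesis by blast
  qed
  obtain W where "W \<subseteq> S" "card W = 3" using more[of "{}" 3] by auto
  then obtain s1 s2 s3 where "s1 \<in> S" "s2 \<in> S" "s3 \<in> S" "distinct [s1, s2, s3]"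
    by (auto simp: card_3_iff)
  then obtain p v1 v2 where v: "p \<in> T" "v1 \<in> S" "v2 \<in> S" "v1 \<noteq> v2" "\<not> R v1 p" "\<not> R v2 p"
    using share[of s1 s2 s3] by auto
  have "\<exists>p u1 u2 u3. p \<in> T \<and> {u1, u2, u3} \<subseteq> S \<and> distinct [u1, u2, u3]
      \<and> \<not> R u1 p \<and> \<not> R u2 p \<and> \<not> R u3 p"
  proof -
    obtain W where W: "W \<subseteq> S" "W \<inter> {v1, v2} = {}" "card W = 3"
      using more[of "{v1, v2}" 3] v(4) by auto
    then obtain x y z where xyz: "W = {x, y, z}" "distinct [x, y, z]" by (auto simp: card_3_iff)
    then have S3: "x \<in> S" "y \<in> S" "z \<in> S" "distinct [v1, x, y]" "distinct [v1, x, z]"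
        "distinct [v1, v2, x]" "distinct [v1, v2, y]" "distinct [v1, v2, z]"
      using W(1,2) v(4) by auto
    show ?thesis
    proof (cases "R x p \<and> R y p \<and> R z p")
      case False
      then show ?thesis using v S3 by blast
    next
      \<comment> \<open>As \<open>v1\<close> is blue only to \<open>p\<close> in \<open>T\<close>,
        \<open>x\<close> and \<open>y\<close> share a blue neighbour, and so do \<open>x\<close> and
        \<open>z\<close>. It is the same one, since \<open>x\<close> has only one.\<close>
      case True
      have v1: "R v1 q" if "q \<in> T" "q \<noteq> p" for q using few[OF v(2)] v that by blast
      obtain q where q: "q \<in> T" "\<not> R x q" "\<not> R y q"
        using share[OF v(2) S3(1,2,4)] v1 True by blast
      obtain q' where q': "q' \<in> T" "\<not> R x q'" "\<not> R z q'"
        using share[OF v(2) S3(1,3,5)] v1 True by blast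
      have "q' = q" using few[OF S3(1)] q q' by blast
      then show ?thesis using q q' S3(1-3) xyz(2) by blast
    qed
  qed
  then obtain p u1 u2 u3 where u: "p \<in> T" "u1 \<in> S" "u2 \<in> S" "u3 \<in> S" "distinct [u1, u2, u3]"
      "\<not> R u1 p" "\<not> R u2 p" "\<not> R u3 p" by auto
  \<comment> \<open>If \<open>w\<close> is blue to \<open>q\<close>, each \<open>x\<close> among the
    three \<open>u\<close>s is red to \<open>w\<close>, or else \<open>x w q r p\<close> is a blue
    pentagon. Then \<open>u1 q u2 r u3 w\<close> is a red hexagon.\<close>
  have foot: "R w q" if wq: "w \<in> S" "q \<in> T" "q \<noteq> p" for w q
  proof (rule ccontr)
    assume n: "\<not> R w q"
    obtain r where r: "r \<in> T" "r \<noteq> p" "r \<noteq> q" using third by blast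
    have uqr: "R x q" "R x r" if "x \<in> {u1, u2, u3}" for x
      using that few u r \<open>q \<in> T\<close> \<open>q \<noteq> p\<close> by blast+
    have w: "w \<notin> {u1, u2, u3}" using uqr n by blast
    have red: "R x w" if x: "x \<in> {u1, u2, u3}" for x
    proof (rule ccontr)
      assume "\<not> R x w"
      moreover have "\<not> R q r" "\<not> R r p" "\<not> R p x"
        using blue r u \<open>q \<in> T\<close> x sym[of p x] by blast+
      moreover have "distinct [x, w, q, r, p]" "{x, w, q, r, p} \<subseteq> V"
        using x w r u wq T(1) by (auto simp: S_def)
      ultimately show False using blue_pentagonE[OF assms(2), of x w q r p] n by blast
    qed
    have "distinct [u1, q, u2, r, u3, w]" "{u1, q, u2, r, u3, w} \<subseteq> V"
      using w r u wq T(1) by (auto simp: S_def)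
    then show False using hexagonI[of R u1 q u2 r u3 w V] uqr[of u1] uqr[of u2] uqr[of u3]
        red[of u1] red[of u3] sym[of q u2] sym[of r u3] sym[of w u1] no by blast
  qed
  obtain W where W: "W \<subseteq> S" "W \<inter> {u1, u2, u3} = {}" "card W = 2"
    using more[of "{u1, u2, u3}" 2] u(5) by auto
  then obtain x y where xy: "W = {x, y}" "x \<noteq> y" by (auto simp: card_2_iff)
  then have xy': "x \<in> S" "y \<in> S" "x \<notin> {u1, u2, u3}" "y \<notin> {u1, u2, u3}" using W by auto
  \<comment> \<open>By \<open>foot\<close>, the blue neighbour shared by two of \<open>u1\<close>,
    \<open>x\<close>, \<open>y\<close> must be \<open>p\<close>.\<close>
  have "\<not> R x p \<or> \<not> R y p"
    using share[OF u(2) xy'(1,2)] xy' xy(2) foot u(2) by auto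
  then obtain u4 where u4: "u4 \<in> S" "u4 \<notin> {u1, u2, u3}" "\<not> R u4 p" using xy' by blast
  obtain q where q: "q \<in> T" "q \<noteq> p" using third by blast
  obtain r where r: "r \<in> T" "r \<noteq> p" "r \<noteq> q" using third by blast
  have "has_cycle R V 6"
  proof (rule hexagon_blue_star[OF assms(1,2)])
    show "distinct [p, q, r, u1, u2, u3, u4]" "{p, q, r, u1, u2, u3, u4} \<subseteq> V"
      using q r u u4 T(1) by (auto simp: S_def)
    show "\<not> R x p \<and> R x q \<and> R x r" if "x \<in> {u1, u2, u3, u4}" for x
    proof -
      have "x \<in> S" "\<not> R x p" using that u u4 by auto
      then show ?thesis using foot q r by blast
    qed
  qed
  then show False using no by blast
qed

section \<open>Red cycles that cannot be extended\<close>

text \<open>\<open>stuck\<close> excludes every red cycle of the next length in \<open>V\<close>,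
  not only those through all of \<open>xs\<close>.\<close>

locale stuck_cycle =
  fixes R :: "'a \<Rightarrow> 'a \<Rightarrow> bool" and V :: "'a set" and xs :: "'a list"
  assumes symp: "symp R" and pent: "blue_pentagon_free R V"
    and cyc: "is_cycle R xs" and sub: "set xs \<subseteq> V" and len: "6 \<le> length xs"
    and stuck: "\<not> has_cycle R V (Suc (length xs))"
begin

abbreviation "succ \<equiv> nxt xs"
abbreviation "pred \<equiv> nxt (rev xs)"

lemma sym: "R x y \<Longrightarrow> R y x"
  using symp by (rule sympD)

lemma dist: "distinct xs"
  using cyc by (simp add: is_cycle_def)

lemma succ_in: "x \<in> set xs \<Longrightarrow> succ x \<in> set xs" and pred_in: "x \<in> set xs \<Longrightarrow> pred x \<in> set xs"
  using nxt_in_set[of x xs] nxt_in_set[of x "rev xs"] by auto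

lemma succ_pred: "x \<in> set xs \<Longrightarrow> succ (pred x) = x" and pred_succ: "x \<in> set xs \<Longrightarrow> pred (succ x) = x"
  by (fact nxt_nxt_rev[OF dist], fact nxt_rev_nxt[OF dist])

lemma succ_inj: "x \<in> set xs \<Longrightarrow> y \<in> set xs \<Longrightarrow> x \<noteq> y \<Longrightarrow> succ x \<noteq> succ y"
  using pred_succ by metis

lemma pred_inj: "x \<in> set xs \<Longrightarrow> y \<in> set xs \<Longrightarrow> x \<noteq> y \<Longrightarrow> pred x \<noteq> pred y"
  using succ_pred by metis

text \<open>Reading the cycle backwards exchanges \<open>succ\<close> and \<open>pred\<close>, so
  each fact about successors has a mirror image.\<close>

lemma reverse: "stuck_cycle R V (rev xs)"
  using symp pent sub len stuck is_cycle_rev[OF symp cyc] by unfold_locales auto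

text \<open>Otherwise \<open>v\<close> could be inserted; \<open>succ_blue\<close> and
  \<open>no_replace\<close> exclude rotation and replacement in the same way.\<close>

lemma not_red_succ:
  assumes "v \<in> V - set xs" "x \<in> set xs" "R v x"
  shows "\<not> R v (succ x)"
proof
  assume "R v (succ x)"
  then have "\<exists>ys. is_cycle R ys \<and> set ys = insert v (set xs) \<and> length ys = Suc (length xs)"
    using assms extend_insert[OF cyc assms(2) _ sym[OF assms(3)]] by blast
  then show False using stuck assms(1) sub unfolding has_cycle_def by auto
qed

lemma succ_blue:
  assumes "v \<in> V - set xs" "x \<in> set xs" "y \<in> set xs" "x \<noteq> y" "R v x" "R v y"
  shows "\<not> R (succ x) (succ y)"
proof
  assume "R (succ x) (succ y)"
  then have "\<exists>ys. is_cycle R ys \<and> set ys = insert v (set xs) \<and> length ys = Suc (length xs)"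
    using assms extend_rotation[OF symp cyc assms(2-4) _ assms(5,6)] by blast
  then show False using stuck assms(1) sub unfolding has_cycle_def by auto
qed

lemma no_replace:
  assumes "u \<in> V - set xs" "v \<in> V - set xs" "R u v" "u \<noteq> v" "x \<in> set xs" "R u (pred x)" "R v (succ x)"
  shows False
proof -
  have "3 \<le> length xs" using len by simp
  then have "\<exists>ys. is_cycle R ys \<and> set ys \<subseteq> {u, v} \<union> set xs \<and> length ys = Suc (length xs)"
    using assms by (intro extend_replace[OF symp cyc assms(5)]) auto
  then show False using stuck assms(1,2) sub unfolding has_cycle_def by blast
qed

lemma not_red_pred: "v \<in> V - set xs \<Longrightarrow> x \<in> set xs \<Longrightarrow> R v x \<Longrightarrow> \<not> R v (pred x)"
  using stuck_cycle.not_red_succ[OF reverse] by simp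

lemma pred_blue:
  "v \<in> V - set xs \<Longrightarrow> x \<in> set xs \<Longrightarrow> y \<in> set xs \<Longrightarrow> x \<noteq> y \<Longrightarrow> R v x \<Longrightarrow> R v y \<Longrightarrow>
    \<not> R (pred x) (pred y)"
  using stuck_cycle.succ_blue[OF reverse] by simp

text \<open>By \<open>succ_blue\<close>, \<open>v\<close> and the successors of its red neighbours \<open>x\<close>, \<open>y\<close>, \<open>z\<close> span a blue \<open>K\<^sub>4\<close>.\<close>

lemma succ_K4_few:
  assumes "v \<in> V - set xs" "{x, y, z} \<subseteq> set xs" "distinct [x, y, z]" "R v x" "R v y" "R v z"
    and "w \<in> V" "w \<notin> {v, succ x, succ y, succ z}"
    and "p \<in> {v, succ x, succ y, succ z}" "q \<in> {v, succ x, succ y, succ z}" "p \<noteq> q"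
  shows "R w p \<or> R w q"
proof (rule blue_K4_few[OF symp pent])
  have m: "x \<in> set xs" "y \<in> set xs" "z \<in> set xs" "x \<noteq> y" "x \<noteq> z" "y \<noteq> z" using assms(2,3) by auto
  note m' = succ_in[OF m(1)] succ_in[OF m(2)] succ_in[OF m(3)]
  show "{v, succ x, succ y, succ z, w} \<subseteq> V" using m' assms(1,7) sub by auto
  have "v \<notin> {succ x, succ y, succ z}" using m' assms(1) by auto
  then show "distinct [v, succ x, succ y, succ z, w]"
    using succ_inj[OF m(1,2,4)] succ_inj[OF m(1,3,5)] succ_inj[OF m(2,3,6)] assms(8) by auto
  show "\<not> R v (succ x)" "\<not> R v (succ y)" "\<not> R v (succ z)"
    using not_red_succ assms(1,4-6) m by blast+
  show "\<not> R (succ x) (succ y)" "\<not> R (succ x) (succ z)" "\<not> R (succ y) (succ z)"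
    using succ_blue assms(1,4-6) m by blast+
qed fact+

lemma pred_K4_few:
  assumes "v \<in> V - set xs" "{x, y, z} \<subseteq> set xs" "distinct [x, y, z]" "R v x" "R v y" "R v z"
    and "w \<in> V" "w \<notin> {v, pred x, pred y, pred z}"
    and "p \<in> {v, pred x, pred y, pred z}" "q \<in> {v, pred x, pred y, pred z}" "p \<noteq> q"
  shows "R w p \<or> R w q"
  using stuck_cycle.succ_K4_few[OF reverse] assms by simp

text \<open>Otherwise \<open>b\<close> and the second successors form another blue
  \<open>K\<^sub>4\<close>. Being blue to \<open>b\<close>, the vertex \<open>c\<close> is red to
  all second successors, but it is also red to a first successor, hence to two consecutive
  vertices.\<close>

lemma three_red_blue_succ:
  assumes abc: "a \<in> V - set xs" "b \<in> V - set xs" "c \<in> V - set xs" "distinct [a, b, c]"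
    and xyz: "{x, y, z} \<subseteq> set xs" "distinct [x, y, z]" "R a x" "R a y" "R a z"
    and bc: "\<not> R b c"
  shows "\<exists>p\<in>{x, y, z}. \<not> R b (succ p)"
proof (rule ccontr)
  assume "\<not> ?thesis"
  then have b: "R b (succ x)" "R b (succ y)" "R b (succ z)" by auto
  have m: "x \<in> set xs" "y \<in> set xs" "z \<in> set xs" "x \<noteq> y" "x \<noteq> z" "y \<noteq> z" using xyz by auto
  note m' = succ_in[OF m(1)] succ_in[OF m(2)] succ_in[OF m(3)]
    succ_inj[OF m(1,2,4)] succ_inj[OF m(1,3,5)] succ_inj[OF m(2,3,6)]
  note m'' = succ_in[OF m'(1)] succ_in[OF m'(2)] succ_in[OF m'(3)]
  have "R c (succ x) \<or> R c (succ y)"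
  proof (rule succ_K4_few[OF abc(1) xyz])
    show "c \<notin> {a, succ x, succ y, succ z}" using m' abc by auto
  qed (use m' abc in auto)
  moreover have "R c b \<or> R c (succ p)" if "p \<in> {succ x, succ y, succ z}" for p
  proof (rule succ_K4_few[OF abc(2) _ _ b])
    show "c \<notin> {b, succ (succ x), succ (succ y), succ (succ z)}" using m'' abc by auto
    show "b \<noteq> succ p" using m'' that abc by auto
    show "{succ x, succ y, succ z} \<subseteq> set xs" "distinct [succ x, succ y, succ z]" using m' by auto
  qed (use that abc in auto)
  moreover have "\<not> R c b" using bc sym by blast
  ultimately show False using not_red_succ[OF abc(3)] m'(1,2) by blast
qed

text \<open>By the \<open>K\<^sub>4\<close> of \<open>a\<close>, both \<open>b\<close> and
  \<open>c\<close> are red to the successors of \<open>y\<close> and \<open>z\<close>. Hence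
  \<open>b\<close>, \<open>c\<close>, \<open>y\<close>, \<open>z\<close> form a blue
  \<open>K\<^sub>4\<close>, and \<open>succ x\<close> cannot be blue to both \<open>b\<close> and
  \<open>c\<close>.\<close>

lemma three_red_common:
  assumes abc: "a \<in> V - set xs" "b \<in> V - set xs" "c \<in> V - set xs" "distinct [a, b, c]"
    and xyz: "{x, y, z} \<subseteq> set xs" "distinct [x, y, z]" "R a x" "R a y" "R a z"
    and bc: "\<not> R b c" "\<not> R b (succ x)" "\<not> R c (succ x)"
  shows False
proof -
  have m: "x \<in> set xs" "y \<in> set xs" "z \<in> set xs" "x \<noteq> y" "x \<noteq> z" "y \<noteq> z" using xyz by auto
  note m' = succ_in[OF m(1)] succ_in[OF m(2)] succ_in[OF m(3)]
    succ_inj[OF m(1,2,4)] succ_inj[OF m(1,3,5)] succ_inj[OF m(2,3,6)]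
  have red: "R w (succ y)" "R w (succ z)" if "w \<in> {b, c}" for w
  proof -
    have "w \<in> V" "w \<notin> {a, succ x, succ y, succ z}" using that abc m' by auto
    then show "R w (succ y)" "R w (succ z)"
      using succ_K4_few[OF abc(1) xyz, of w "succ x"] that bc(2,3) m' by blast+
  qed
  have "R (succ x) b \<or> R (succ x) c"
  proof (rule blue_K4_few[OF symp pent])
    have "succ x \<noteq> y" "succ x \<noteq> z"
      using not_red_succ[OF abc(1) m(1) xyz(3)] xyz(4,5) by auto
    then show "distinct [b, c, y, z, succ x]" using abc m m' by auto
    show "{b, c, y, z, succ x} \<subseteq> V" using abc m m' sub by auto
    show "\<not> R b c" by fact
    show "\<not> R b y" "\<not> R b z" "\<not> R c y" "\<not> R c z"
      using not_red_pred[OF abc(2) m'(2)] not_red_pred[OF abc(2) m'(3)]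
        not_red_pred[OF abc(3) m'(2)] not_red_pred[OF abc(3) m'(3)] red
        pred_succ[OF m(2)] pred_succ[OF m(3)] by auto
    show "\<not> R y z"
      using pred_blue[OF abc(2) m'(2,3,6)] red pred_succ[OF m(2)] pred_succ[OF m(3)] by auto
    show "b \<noteq> c" using abc by auto
  qed auto
  then show False using bc sym by blast
qed

text \<open>If \<open>b c\<close> is red, \<open>b\<close> misses at most one of the three
  predecessors and \<open>c\<close> at most one of the three successors, so \<open>b\<close>,
  \<open>c\<close> can replace one of \<open>x\<close>, \<open>y\<close>, \<open>z\<close>. If it is
  blue, each of \<open>b\<close> and \<open>c\<close> is blue to a successor: different ones give a
  blue pentagon through \<open>a\<close>, a common one contradicts
  \<open>three_red_common\<close>.\<close>

lemma not_three_red: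
  assumes abc: "a \<in> V - set xs" "b \<in> V - set xs" "c \<in> V - set xs" "distinct [a, b, c]"
    and xyz: "{x, y, z} \<subseteq> set xs" "distinct [x, y, z]" "R a x" "R a y" "R a z"
  shows False
proof (cases "R b c")
  case True
  have m: "x \<in> set xs" "y \<in> set xs" "z \<in> set xs" "x \<noteq> y" "x \<noteq> z" "y \<noteq> z" using xyz by auto
  have ne: "succ x \<noteq> succ y" "succ x \<noteq> succ z" "succ y \<noteq> succ z"
    "pred x \<noteq> pred y" "pred x \<noteq> pred z" "pred y \<noteq> pred z"
    using succ_inj pred_inj m by blast+
  have "b \<notin> {a, pred x, pred y, pred z}" "c \<notin> {a, succ x, succ y, succ z}"
    using m succ_in pred_in abc by auto
  then have "(R b (pred x) \<or> R b (pred y)) \<and> (R b (pred x) \<or> R b (pred z)) \<and> (R b (pred y) \<or> R b (pred z))"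
    "(R c (succ x) \<or> R c (succ y)) \<and> (R c (succ x) \<or> R c (succ z)) \<and> (R c (succ y) \<or> R c (succ z))"
    using pred_K4_few[OF abc(1) xyz, of b] succ_K4_few[OF abc(1) xyz, of c] abc ne by auto
  then have "\<exists>p\<in>{x, y, z}. R b (pred p) \<and> R c (succ p)" by auto
  then show False using no_replace[OF abc(2,3) True] abc(4) xyz(1) by auto
next
  case False
  have False': "\<not> R c b" using False sym by blast
  obtain p where p: "p \<in> {x, y, z}" "\<not> R b (succ p)"
    using three_red_blue_succ[OF abc xyz False] by blast
  obtain q where q: "q \<in> {x, y, z}" "\<not> R c (succ q)"
    using three_red_blue_succ[OF abc(1,3,2) _ xyz False'] abc(4) by auto
  have pq: "p \<in> set xs" "q \<in> set xs" "R a p" "R a q" using p q xyz by auto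
  have "p = q"
  proof (rule ccontr)
    assume "p \<noteq> q"
    then have "succ p \<noteq> succ q" using succ_inj pq by blast
    moreover have "succ p \<in> set xs" "succ q \<in> set xs" using succ_in pq by auto
    ultimately have "distinct [b, succ p, a, succ q, c]" "{b, succ p, a, succ q, c} \<subseteq> V"
      using abc sub by auto
    moreover have "\<not> R (succ p) a" "\<not> R a (succ q)"
      using not_red_succ[OF abc(1)] pq sym by blast+
    moreover have "\<not> R (succ q) c" using q sym by blast
    ultimately show False using blue_pentagonE[OF pent p(2)] False' by blast
  qed
  obtain y' z' where "{p, y', z'} = {x, y, z}" "distinct [p, y', z']"
  proof -
    have "\<exists>y' z'. {p, y', z'} = {x, y, z} \<and> distinct [p, y', z']"
      using p(1) xyz(2) by (auto simp: insert_commute)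
    then show thesis using that by blast
  qed
  moreover from this have "R a p" "R a y'" "R a z'" using xyz by auto
  ultimately show False
    using three_red_common[OF abc, of p y' z'] xyz(1) False p(2) q(2) \<open>p = q\<close> by auto
qed

end

section \<open>Three vertices outside a stuck cycle\<close>

lemma card_ge_2_obtain:
  assumes "2 \<le> card X" "2 \<le> card Y"
  obtains x y where "x \<in> X" "y \<in> Y" "x \<noteq> y"
proof -
  have X: "card X \<noteq> 0" using assms(1) by simp
  then obtain x where x: "x \<in> X" by fastforce
  have "\<not> Y \<subseteq> {x}" using assms(2) card_mono[of "{x}" Y] by auto
  then show thesis using that x by blast
qed

locale stuck_cycle3 = stuck_cycle +
  fixes a b c
  assumes abc: "{a, b, c} \<subseteq> V - set xs" "distinct [a, b, c]"
begin

definition red_nbrs where "red_nbrs v = {x \<in> set xs. R v x}"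
definition blue_nbrs where "blue_nbrs v = {x \<in> set xs. \<not> R v x}"

lemma reverse3: "stuck_cycle3 R V (rev xs) a b c"
  using reverse abc by (intro stuck_cycle3.intro) (simp_all add: stuck_cycle3_axioms_def)

lemma others:
  assumes "v \<in> {a, b, c}"
  obtains u w where "u \<in> {a, b, c}" "w \<in> {a, b, c}" "distinct [v, u, w]"
  using assms abc(2) by auto

lemma outside: "v \<in> {a, b, c} \<Longrightarrow> v \<in> V - set xs"
  using abc(1) by blast

lemma card_set: "card (set xs) = length xs"
  using dist by (rule distinct_card)

lemma red_nbrs_le_2:
  assumes "v \<in> {a, b, c}"
  shows "card (red_nbrs v) \<le> 2"
proof (rule ccontr)
  assume "\<not> ?thesis"
  then have "3 \<le> card (red_nbrs v)" by simp
  then obtain X where "X \<subseteq> red_nbrs v" "card X = 3" by (rule obtain_subset_with_card_n)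
  then obtain x y z where xyz: "{x, y, z} \<subseteq> red_nbrs v" "distinct [x, y, z]"
    by (auto simp: card_3_iff)
  obtain u w where "u \<in> {a, b, c}" "w \<in> {a, b, c}" "distinct [v, u, w]" using others[OF assms] .
  then show False
    using not_three_red[of v u w x y z] outside assms xyz by (auto simp: red_nbrs_def)
qed

lemma card_common:
  "length xs \<le> card (blue_nbrs v \<inter> blue_nbrs w) + card (red_nbrs v) + card (red_nbrs w)"
proof -
  have "set xs = (blue_nbrs v \<inter> blue_nbrs w) \<union> red_nbrs v \<union> red_nbrs w"
    by (auto simp: blue_nbrs_def red_nbrs_def)
  then show ?thesis
    using card_set card_Un_le[of "blue_nbrs v \<inter> blue_nbrs w" "red_nbrs v"]
      card_Un_le[of "(blue_nbrs v \<inter> blue_nbrs w) \<union> red_nbrs v" "red_nbrs w"] by simp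
qed

text \<open>The cycle has at least six vertices, and \<open>v\<close> and \<open>w\<close> are red
  to at most two of them each.\<close>

lemma two_common:
  assumes "v \<in> {a, b, c}" "w \<in> {a, b, c}"
  shows "2 \<le> card (blue_nbrs v \<inter> blue_nbrs w)"
  using card_common[of v w] red_nbrs_le_2[OF assms(1)] red_nbrs_le_2[OF assms(2)] len by linarith

text \<open>Were \<open>v w\<close> blue, the third vertex \<open>u\<close> would share a blue
  neighbour \<open>x\<close> with \<open>w\<close> and another, \<open>y\<close>, with
  \<open>v\<close>, giving the blue pentagon \<open>v w x u y\<close>.\<close>

lemma red_triangle:
  assumes "v \<in> {a, b, c}" "w \<in> {a, b, c}" "v \<noteq> w"
  shows "R v w"
proof (rule ccontr)
  assume n: "\<not> R v w"
  obtain u where u: "u \<in> {a, b, c}" "u \<noteq> v" "u \<noteq> w" using assms abc(2) by auto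
  obtain x y where xy: "x \<in> blue_nbrs w \<inter> blue_nbrs u" "y \<in> blue_nbrs u \<inter> blue_nbrs v" "x \<noteq> y"
    using card_ge_2_obtain[OF two_common[OF assms(2) u(1)] two_common[OF u(1) assms(1)]] .
  have "distinct [v, w, x, u, y]" "{v, w, x, u, y} \<subseteq> V"
    using outside[OF assms(1)] outside[OF assms(2)] outside[OF u(1)] assms(3) u(2,3) xy sub
    by (auto simp: blue_nbrs_def)
  moreover have "\<not> R w x" "\<not> R x u" "\<not> R u y" "\<not> R y v"
    using xy sym unfolding blue_nbrs_def by blast+
  ultimately show False using blue_pentagonE[OF pent n] by blast
qed

text \<open>A further common blue neighbour \<open>z\<close> would give the blue pentagon
  \<open>v x y w z\<close>.\<close>

lemma blue_edge_cases:
  assumes "v \<in> {a, b, c}" "w \<in> {a, b, c}" "v \<noteq> w" "x \<in> blue_nbrs v" "y \<in> blue_nbrs w" "x \<noteq> y"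
    "\<not> R x y"
  shows "blue_nbrs v \<inter> blue_nbrs w \<subseteq> {x, y}"
proof (rule ccontr)
  assume "\<not> ?thesis"
  then obtain z where z: "z \<in> blue_nbrs v" "z \<in> blue_nbrs w" "z \<noteq> x" "z \<noteq> y" by blast
  have "distinct [v, x, y, w, z]" "{v, x, y, w, z} \<subseteq> V"
    using outside[OF assms(1)] outside[OF assms(2)] assms(3-6) z sub
    by (auto simp: blue_nbrs_def)
  moreover have "\<not> R v x" "\<not> R y w" "\<not> R w z" "\<not> R z v"
    using assms(4,5) z sym unfolding blue_nbrs_def by blast+
  ultimately show False using blue_pentagonE[OF pent] assms(7) by blast
qed

lemma blue_pair_red_or_common:
  assumes "v \<in> {a, b, c}" "w \<in> {a, b, c}" "v \<noteq> w" "x \<in> blue_nbrs v" "y \<in> blue_nbrs v" "x \<noteq> y"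
    "\<not> R x y"
  shows "{x, y} \<subseteq> red_nbrs w \<or> blue_nbrs v \<inter> blue_nbrs w = {x, y}"
proof (cases "{x, y} \<subseteq> red_nbrs w")
  case False
  then have "x \<in> blue_nbrs w \<or> y \<in> blue_nbrs w"
    using assms(4,5) by (auto simp: blue_nbrs_def red_nbrs_def)
  moreover have "\<not> R y x" using assms(7) sym by blast
  ultimately have "blue_nbrs v \<inter> blue_nbrs w \<subseteq> {x, y}"
    using blue_edge_cases[OF assms(1-3,5), of x] blue_edge_cases[OF assms(1-4), of y] assms(6,7)
    by blast
  moreover have "card {x, y} = 2" using assms(6) by simp
  ultimately have "blue_nbrs v \<inter> blue_nbrs w = {x, y}"
    using two_common[OF assms(1,2)] by (intro card_seteq) auto
  then show ?thesis by blast
qed simp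

text \<open>\<open>v\<close> and \<open>w\<close> have no other red neighbours. The second
  successors form a blue edge with both ends blue to \<open>v\<close> and \<open>w\<close>, so no
  further common blue neighbour exists; yet at most four vertices are accounted for, out of at least
  six.\<close>

lemma not_both_red_to_succs:
  assumes "v \<in> {a, b, c}" "w \<in> {a, b, c}" "v \<noteq> w" "x \<in> set xs" "y \<in> set xs" "x \<noteq> y"
    "{succ x, succ y} \<subseteq> red_nbrs v" "{succ x, succ y} \<subseteq> red_nbrs w"
  shows False
proof -
  let ?E = "{succ x, succ y}" and ?F = "{succ (succ x), succ (succ y)}"
  have m: "succ x \<in> set xs" "succ y \<in> set xs" "succ x \<noteq> succ y"
    using succ_in succ_inj assms(4-6) by blast+
  then have m': "succ (succ x) \<in> set xs" "succ (succ y) \<in> set xs" "succ (succ x) \<noteq> succ (succ y)"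
    using succ_in succ_inj by blast+
  have red: "red_nbrs u = ?E" if "u \<in> {v, w}" for u
  proof -
    have u: "u \<in> {a, b, c}" "?E \<subseteq> red_nbrs u" using that assms(1,2,7,8) by blast+
    have "card (red_nbrs u) \<le> card ?E" using red_nbrs_le_2[OF u(1)] m(3) by simp
    then show ?thesis using card_seteq[OF _ u(2)] by (simp add: red_nbrs_def)
  qed
  have "card (?E \<union> ?F) \<le> 4" by (simp add: card_insert_if)
  then have "\<not> set xs \<subseteq> ?E \<union> ?F"
    using card_mono[of "?E \<union> ?F" "set xs"] card_set len by auto
  then obtain z where z: "z \<in> set xs" "z \<notin> ?E" "z \<notin> ?F" by blast
  have F: "succ (succ x) \<in> blue_nbrs u" "succ (succ y) \<in> blue_nbrs u" if "u \<in> {v, w}" for u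
    using not_red_succ[of u "succ x"] not_red_succ[of u "succ y"] outside that assms(1,2,7,8) m m'
    by (auto simp: blue_nbrs_def red_nbrs_def)
  have "\<not> R (succ (succ x)) (succ (succ y))"
    using succ_blue[of v "succ x" "succ y"] outside[OF assms(1)] assms(7) m by (auto simp: red_nbrs_def)
  then have "blue_nbrs v \<inter> blue_nbrs w \<subseteq> ?F"
    using blue_edge_cases[OF assms(1-3)] F m'(3) by auto
  moreover have "z \<in> blue_nbrs v \<inter> blue_nbrs w"
    using z red by (auto simp: blue_nbrs_def red_nbrs_def)
  ultimately show False using z by blast
qed

text \<open>The successors and the predecessors of two red neighbours \<open>x\<close>,
  \<open>y\<close> are two different blue pairs, and each of \<open>u\<close>, \<open>w\<close> is
  red to one whole pair by \<open>blue_pair_red_or_common\<close>. The same pair contradicts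
  \<open>not_both_red_to_succs\<close> or its mirror image; different pairs let \<open>u\<close> and
  \<open>w\<close> replace \<open>x\<close>.\<close>

lemma red_nbrs_le_1:
  assumes "v \<in> {a, b, c}" "x \<in> red_nbrs v" "y \<in> red_nbrs v"
  shows "x = y"
proof (rule ccontr)
  assume "x \<noteq> y"
  interpret r: stuck_cycle3 R V "rev xs" a b c by (rule reverse3)
  have nbrs [simp]: "r.red_nbrs = red_nbrs" "r.blue_nbrs = blue_nbrs"
    by (auto simp: fun_eq_iff r.red_nbrs_def r.blue_nbrs_def red_nbrs_def blue_nbrs_def)
  have xy: "x \<in> set xs" "y \<in> set xs" "R v x" "R v y" using assms by (auto simp: red_nbrs_def)
  note v = outside[OF assms(1)]
  obtain u w where uw: "u \<in> {a, b, c}" "w \<in> {a, b, c}" "distinct [v, u, w]"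
    using others[OF assms(1)] .
  have s: "succ x \<in> blue_nbrs v" "succ y \<in> blue_nbrs v" "succ x \<noteq> succ y" "\<not> R (succ x) (succ y)"
    using not_red_succ[OF v] succ_in succ_inj succ_blue[OF v] xy \<open>x \<noteq> y\<close>
    by (auto simp: blue_nbrs_def)
  have p: "pred x \<in> blue_nbrs v" "pred y \<in> blue_nbrs v" "pred x \<noteq> pred y" "\<not> R (pred x) (pred y)"
    using not_red_pred[OF v] pred_in pred_inj pred_blue[OF v] xy \<open>x \<noteq> y\<close>
    by (auto simp: blue_nbrs_def)
  \<comment> \<open>Equal pairs would make the cycle return to \<open>x\<close> after four
    steps.\<close>
  have "{succ x, succ y} \<noteq> {pred x, pred y}"
  proof
    assume e: "{succ x, succ y} = {pred x, pred y}"
    have f: "(succ ^^ n) x \<noteq> x" if "0 < n" "n \<le> 4" for n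
      using nxt_funpow_neq[OF dist xy(1) that(1)] that(2) len by simp
    have "succ x \<noteq> pred x" using succ_pred[OF xy(1)] f[of 2] by (auto simp: numeral_eq_Suc)
    then have "succ x = pred y" "succ y = pred x" using e unfolding doubleton_eq_iff by blast+
    then have "succ (succ x) = y" "succ (succ y) = x" using succ_pred xy by simp_all
    then show False using f[of 4] by (simp add: numeral_eq_Suc)
  qed
  then have *: "{succ x, succ y} \<subseteq> red_nbrs t \<or> {pred x, pred y} \<subseteq> red_nbrs t"
    if "t \<in> {u, w}" for t
    using blue_pair_red_or_common[OF assms(1) _ _ s, of t]
      blue_pair_red_or_common[OF assms(1) _ _ p, of t] that uw by auto
  have uw': "u \<noteq> w" "R u w" "R w u" using uw red_triangle by auto
  consider "{succ x, succ y} \<subseteq> red_nbrs u" "{succ x, succ y} \<subseteq> red_nbrs w"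
    | "{pred x, pred y} \<subseteq> red_nbrs u" "{pred x, pred y} \<subseteq> red_nbrs w"
    | "R u (pred x)" "R w (succ x)" | "R w (pred x)" "R u (succ x)"
    using *[of u] *[of w] by (auto simp: red_nbrs_def)
  then show False
  proof cases
    case 1
    then show False using not_both_red_to_succs[OF uw(1,2) uw'(1) xy(1,2) \<open>x \<noteq> y\<close>] by blast
  next
    case 2
    then show False using r.not_both_red_to_succs[OF uw(1,2) uw'(1)] xy \<open>x \<noteq> y\<close> by simp
  next
    case 3
    then show False using no_replace outside uw uw' xy(1) by blast
  next
    case 4
    then show False using no_replace outside uw uw' xy(1) by metis
  qed
qed

text \<open>Two outside vertices now have at least four common blue neighbours, which sharpens
  \<open>blue_edge_cases\<close> to \<open>edge\<close>. So if two vertices of the cycle are joined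
  in blue, \<open>a\<close>, \<open>b\<close>, \<open>c\<close> have a common red neighbour that
  lies on all such edges; it moves to their clique.\<close>

theorem two_cliques_stuck: "two_cliques R ({a, b, c} \<union> set xs)"
proof -
  have le1: "card (red_nbrs v) \<le> 1" if "v \<in> {a, b, c}" for v
    using red_nbrs_le_1[OF that] by (auto simp: card_le_Suc0_iff_eq red_nbrs_def)
  have edge: "R v x \<or> R w y"
    if "v \<in> {a, b, c}" "w \<in> {a, b, c}" "v \<noteq> w" "x \<in> set xs" "y \<in> set xs" "x \<noteq> y" "\<not> R x y" for v w x y
  proof (rule ccontr)
    assume "\<not> ?thesis"
    then have "blue_nbrs v \<inter> blue_nbrs w \<subseteq> {x, y}"
      using blue_edge_cases that by (auto simp: blue_nbrs_def)
    then have "card (blue_nbrs v \<inter> blue_nbrs w) \<le> card {x, y}" by (intro card_mono) auto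
    also have "\<dots> \<le> 2" by (simp add: card_insert_if)
    finally show False using card_common[of v w] le1[OF that(1)] le1[OF that(2)] len by linarith
  qed
  have ne: "a \<noteq> b" "a \<noteq> c" "b \<noteq> c" using abc(2) by auto
  have tri: "pairwise R {a, b, c}" using red_triangle by (auto simp: pairwise_def)
  show ?thesis
  proof (cases "pairwise R (set xs)")
    case True
    then show ?thesis using tri two_cliquesI by blast
  next
    case False
    then obtain x0 y0 where xy0: "x0 \<in> set xs" "y0 \<in> set xs" "x0 \<noteq> y0" "\<not> R x0 y0"
      unfolding pairwise_def by blast
    have uniq: "x = y" if "v \<in> {a, b, c}" "R v x" "R v y" "x \<in> set xs" "y \<in> set xs" for v x y
      using red_nbrs_le_1[OF that(1)] that by (auto simp: red_nbrs_def)
    have "\<exists>x\<in>set xs. \<forall>v\<in>{a, b, c}. R v x"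
      using edge[of a b x0 y0] edge[of b a x0 y0] edge[of a c x0 y0] edge[of c a x0 y0]
        edge[of b c x0 y0] edge[of c b x0 y0] xy0 ne uniq[of a x0 y0] uniq[of b x0 y0] uniq[of c x0 y0]
      by auto
    then obtain x where x: "x \<in> set xs" "\<And>v. v \<in> {a, b, c} \<Longrightarrow> R v x" by blast
    have "pairwise R (set xs - {x})"
      using edge[of a b] uniq[of a x] uniq[of b x] x ne unfolding pairwise_def
      by (metis DiffE insertCI)
    moreover have "pairwise R (insert x {a, b, c})"
      using tri x(2) sym[OF x(2)] unfolding pairwise_insert by blast
    ultimately show ?thesis using x(1) by (intro two_cliquesI[of "insert x {a, b, c}" "set xs - {x}"]) auto
  qed
qed

end

section \<open>Blue triangles without blue pentagons\<close>

lemma two_cliques_blue_triangle_free: "two_cliques R V \<Longrightarrow> blue_triangle_free R V"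
  unfolding two_cliques_def blue_triangle_free_def pairwise_def by (auto; blast)

lemma blue_triangle_free_mono: "blue_triangle_free R V \<Longrightarrow> U \<subseteq> V \<Longrightarrow> blue_triangle_free R U"
  unfolding blue_triangle_free_def by blast

lemma blue_pentagon_free_mono: "blue_pentagon_free R V \<Longrightarrow> U \<subseteq> V \<Longrightarrow> blue_pentagon_free R U"
  unfolding blue_pentagon_free_def by blast

text \<open>\<open>T\<close> is fixed so that deletions preserve the blue triangle, down to eight
  vertices and a hexagon. Upwards, a cycle of length \<open>k\<close> among \<open>k + 3\<close>
  vertices leaves exactly three outside; it is not stuck, since two red cliques admit no blue
  triangle.\<close>

lemma blue_triangle_cycle_exact:
  assumes "symp R" "6 \<le> k" "blue_pentagon_free R V" "card V = k + 2" "T \<subseteq> V" "card T = 3"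
    "\<not> blue_triangle_free R T"
  shows "has_cycle R V k"
  using assms(2-5)
proof (induction k arbitrary: V rule: nat_induct_at_least)
  case base
  obtain x y z where "x \<in> T" "y \<in> T" "z \<in> T" "distinct [x, y, z]"
      "\<not> R x y" "\<not> R y z" "\<not> R x z"
    using assms(7) unfolding blue_triangle_free_def by blast
  then show ?case
    using hexagon_blue_triangle[OF assms(1) base(1), of x y z] base by auto
next
  case (Suc k)
  have fin: "finite V" using Suc.prems(2) card.infinite by fastforce
  have "\<not> V \<subseteq> T"
    using Suc.prems(2) Suc.hyps assms(6) card_mono[of T V] card.infinite[of T] by fastforce
  then obtain z where z: "z \<in> V" "z \<notin> T" by blast
  have "has_cycle R (V - {z}) k"
  proof (rule Suc.IH)
    show "blue_pentagon_free R (V - {z})" using blue_pentagon_free_mono[OF Suc.prems(1)] by blast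
    show "card (V - {z}) = k + 2" using Suc.prems(2) z(1) by simp
    show "T \<subseteq> V - {z}" using Suc.prems(3) z(2) by blast
  qed
  then obtain xs where xs: "is_cycle R xs" "set xs \<subseteq> V" "length xs = k"
    unfolding has_cycle_def by blast
  have "card (set xs) = k" using xs by (simp add: is_cycle_def distinct_card)
  then have "card (V - set xs) = 3" using xs(2) Suc.prems(2) by (simp add: card_Diff_subset)
  then obtain a b c where V3: "V - set xs = {a, b, c}" "distinct [a, b, c]"
    by (auto simp: card_3_iff)
  show ?case
  proof (rule ccontr)
    assume "\<not> ?case"
    then have "stuck_cycle R V xs"
      using xs Suc.hyps by (intro stuck_cycle.intro assms(1) Suc.prems(1)) simp_all
    then interpret stuck_cycle3 R V xs a b c
      using equalityD2[OF V3(1)] V3(2) by (intro stuck_cycle3.intro stuck_cycle3_axioms.intro)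
    have "{a, b, c} \<union> set xs = V" using V3(1) xs(2) by blast
    then have "two_cliques R V" using two_cliques_stuck by simp
    then have "blue_triangle_free R V" by (rule two_cliques_blue_triangle_free)
    then show False using blue_triangle_free_mono[OF _ Suc.prems(3)] assms(7) by blast
  qed
qed

theorem pentagon_free_cycle:
  assumes "symp R" "finite V" "blue_pentagon_free R V" "\<not> two_cliques R V" "6 \<le> k" "k + 2 \<le> card V"
  shows "has_cycle R V k"
proof (cases "blue_triangle_free R V")
  case True
  then show ?thesis using triangle_free_cycles(2)[OF assms(1,2) _ assms(4)] assms(5,6) by simp
next
  case False
  then obtain x y z where xyz: "x \<in> V" "y \<in> V" "z \<in> V" "distinct [x, y, z]"
      "\<not> R x y" "\<not> R y z" "\<not> R x z"
    unfolding blue_triangle_free_def by blast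
  let ?T = "{x, y, z}"
  have T: "?T \<subseteq> V" "card ?T = 3" "\<not> blue_triangle_free R ?T"
    using xyz unfolding blue_triangle_free_def by auto
  then have "k - 1 \<le> card (V - ?T)" using assms(6) by (simp add: card_Diff_subset)
  then obtain U where U: "U \<subseteq> V - ?T" "card U = k - 1" by (rule obtain_subset_with_card_n)
  have "finite U" using U(1) assms(2) by (meson finite_Diff finite_subset)
  then have "card (U \<union> ?T) = k + 2"
    using U T(2) assms(5) by (subst card_Un_disjoint) auto
  moreover have "U \<union> ?T \<subseteq> V" using U(1) T(1) by blast
  ultimately have "has_cycle R (U \<union> ?T) k"
    using blue_triangle_cycle_exact[OF assms(1,5) _ _ _ T(2,3)] blue_pentagon_free_mono[OF assms(3)]
    by blast
  then show ?thesis using has_cycle_mono \<open>U \<union> ?T \<subseteq> V\<close> by blast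
qed

section \<open>The order of critical graphs\<close>

lemma has_cycle_clique:
  assumes "pairwise R A" "card A = k" "2 \<le> k"
  shows "has_cycle R A k"
proof -
  have "finite A" using assms(2,3) card.infinite by fastforce
  then obtain xs where xs: "set xs = A" "distinct xs" using finite_distinct_list by blast
  then have l: "length xs = k" using assms(2) distinct_card[of xs] by simp
  obtain x y ys where e: "xs = x # y # ys"
    using l assms(3) by (cases xs; cases "tl xs") auto
  have "last xs \<in> A" "hd xs \<in> A" "last xs \<noteq> hd xs" using xs e by auto
  then have "R (last xs) (hd xs)" using assms(1) unfolding pairwise_def by blast
  moreover have "successively R xs" using pairwise_imp_successively[OF assms(1) xs(2)] xs(1) by simp
  ultimately have "is_cycle R xs" using xs(2) e by (simp add: is_cycle_def)
  then show ?thesis using xs(1) l by (auto intro: has_cycleI)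
qed

text \<open>Links lists to copies: vertex \<open>i\<close> is sent to entry
  \<open>i\<close>.\<close>

lemma contains_copy_cycle_graph:
  assumes "has_cycle (\<lambda>x y. edge_colour G {x, y} = col) (vertices G) k" "3 \<le> k"
  shows "contains_copy (colour_graph col G) (cycle_graph k)"
proof -
  obtain xs where xs: "is_cycle (\<lambda>x y. edge_colour G {x, y} = col) xs" "set xs \<subseteq> vertices G" "length xs = k"
    using assms(1) by (auto simp: has_cycle_def)
  have ne: "xs \<noteq> []" and d: "distinct xs"
    and e: "\<And>i. Suc i < k \<Longrightarrow> edge_colour G {xs ! i, xs ! Suc i} = col"
    and l: "edge_colour G {last xs, hd xs} = col"
    using xs(1,3) unfolding is_cycle_def successively_conv_nth by auto
  have nth_V: "xs ! i \<in> vertices G" if "i < k" for i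
    using xs(2,3) nth_mem[of i xs] that by blast
  have "{xs ! i, xs ! (Suc i mod k)} \<in> nsets (vertices G) 2
      \<and> edge_colour G {xs ! i, xs ! (Suc i mod k)} = col" if "i < k" for i
  proof -
    have j: "Suc i mod k < k" "Suc i mod k \<noteq> i" using that assms(2) by (auto simp: mod_Suc)
    then have "xs ! i \<noteq> xs ! (Suc i mod k)"
      using that xs(3) nth_eq_iff_index_eq[OF d, of i "Suc i mod k"] by metis
    then have "{xs ! i, xs ! (Suc i mod k)} \<in> nsets (vertices G) 2"
      using nth_V[OF that] nth_V[OF j(1)] by simp
    moreover have "edge_colour G {xs ! i, xs ! (Suc i mod k)} = col"
    proof (cases "Suc i = k")
      \<comment> \<open>The edge from \<open>k - 1\<close> to \<open>0\<close> comes from the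
        closing edge of the list.\<close>
      case True
      then have "last xs = xs ! i" using xs(3) ne by (simp add: last_conv_nth flip: True)
      then show ?thesis using l True ne by (simp add: hd_conv_nth)
    next
      case False
      then show ?thesis using e that by simp
    qed
    ultimately show ?thesis by blast
  qed
  then show ?thesis
    using xs(3) nth_V inj_on_nth[OF d, of "{..<k}"]
    unfolding contains_copy_def cycle_graph_def colour_graph_def
    by (intro exI[of _ "\<lambda>i. xs ! i"]) (auto simp del: doubleton_in_nsets_2)
qed

section \<open>Two red cliques joined in blue\<close>

definition split_graph :: "nat \<Rightarrow> nat \<Rightarrow> nat red_blue_graph" where
  "split_graph b N = \<lparr>vertices = {..<N},
     edge_colour = (\<lambda>e. if (\<exists>x\<in>e. x < b) \<and> (\<exists>y\<in>e. b \<le> y) then Blue else Red)\<rparr>"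

lemma split_graph_copyE:
  assumes "contains_copy (colour_graph col (split_graph b N)) (cycle_graph k)"
  obtains f where "inj_on f {..<k}" "\<And>i. i < k \<Longrightarrow> f i < N"
    "\<And>i. i < k \<Longrightarrow> (f i < b \<longleftrightarrow> f (Suc i mod k) < b) \<longleftrightarrow> col = Red"
proof -
  obtain f where f: "inj_on f {..<k}" "f ` {..<k} \<subseteq> {..<N}"
    and img: "\<forall>e\<in>snd (cycle_graph k). f ` e \<in> snd (colour_graph col (split_graph b N))"
    using assms unfolding contains_copy_def
    by (auto simp: cycle_graph_def colour_graph_def split_graph_def)
  have e: "f ` {i, Suc i mod k} \<in> snd (colour_graph col (split_graph b N))" if "i < k" for i
    using that by (intro img[rule_format]) (auto simp: cycle_graph_def)
  show thesis
  proof (rule that[OF f(1)])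
    show "f i < N" if "i < k" for i using f(2) that by auto
    show "(f i < b \<longleftrightarrow> f (Suc i mod k) < b) \<longleftrightarrow> col = Red" if "i < k" for i
      using e[OF that] by (auto simp: split_graph_def colour_graph_def not_less split: if_splits)
  qed
qed

text \<open>Red edges do not lead from one clique to the other, so the cycle stays in one of
  them.\<close>

lemma split_graph_red:
  assumes "contains_copy (colour_graph Red (split_graph b N)) (cycle_graph k)"
  shows "k \<le> max b (N - b)"
proof -
  obtain f where f: "inj_on f {..<k}" "\<And>i. i < k \<Longrightarrow> f i < N"
      "\<And>i. i < k \<Longrightarrow> f i < b \<longleftrightarrow> f (Suc i mod k) < b"
    using split_graph_copyE[OF assms] by (metis (full_types))
  have same: "f i < b \<longleftrightarrow> f 0 < b" if "i < k" for i
    using that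
  proof (induction i)
    case (Suc i)
    then have "Suc i mod k = Suc i" "f i < b \<longleftrightarrow> f 0 < b" by simp_all
    then show ?case using f(3)[of i] Suc.prems by auto
  qed simp
  have "f ` {..<k} \<subseteq> {..<b} \<or> f ` {..<k} \<subseteq> {b..<N}"
    using same f(2) by (cases "f 0 < b") (auto simp: not_less)
  then have "card (f ` {..<k}) \<le> b \<or> card (f ` {..<k}) \<le> N - b"
    using card_mono[of "{..<b}" "f ` {..<k}"] card_mono[of "{b..<N}" "f ` {..<k}"] by auto
  then show ?thesis using card_image[OF f(1)] by auto
qed

text \<open>A blue cycle alternates: the cyclic shift of indices injects each side into the other,
  so exactly half of the vertices lie below \<open>b\<close>.\<close>

lemma split_graph_blue:
  assumes "contains_copy (colour_graph Blue (split_graph b N)) (cycle_graph k)"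
  shows "even k" "k \<le> 2 * b"
proof -
  obtain f where f: "inj_on f {..<k}" "\<And>i. i < k \<Longrightarrow> f i < N"
      "\<And>i. i < k \<Longrightarrow> \<not> (f i < b \<longleftrightarrow> f (Suc i mod k) < b)"
    using split_graph_copyE[OF assms] by (metis colour.distinct(1))
  define J where "J = {i. i < k \<and> f i < b}"
  define J' where "J' = {i. i < k \<and> \<not> f i < b}"
  have inj: "inj_on (\<lambda>i. Suc i mod k) {..<k}"
    by (auto simp: inj_on_def mod_Suc split: if_splits)
  have fin: "finite J" "finite J'" by (auto simp: J_def J'_def)
  have "(\<lambda>i. Suc i mod k) ` J \<subseteq> J'" "(\<lambda>i. Suc i mod k) ` J' \<subseteq> J"
  proof -
    have "Suc i mod k \<in> J'" if "i \<in> J" for i using that f(3)[of i] by (simp add: J_def J'_def)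
    then show "(\<lambda>i. Suc i mod k) ` J \<subseteq> J'" by blast
    have "Suc i mod k \<in> J" if "i \<in> J'" for i using that f(3)[of i] by (simp add: J_def J'_def)
    then show "(\<lambda>i. Suc i mod k) ` J' \<subseteq> J" by blast
  qed
  moreover have "inj_on (\<lambda>i. Suc i mod k) J" "inj_on (\<lambda>i. Suc i mod k) J'"
    by (rule inj_on_subset[OF inj]; auto simp: J_def J'_def)+
  ultimately have "card J = card J'"
    using card_inj_on_le[of "\<lambda>i. Suc i mod k"] fin by (meson le_antisym)
  moreover have "J \<union> J' = {..<k}" "J \<inter> J' = {}" by (auto simp: J_def J'_def)
  then have "card J + card J' = k" using card_Un_disjoint[OF fin] by simp
  ultimately have k: "k = 2 * card J" by simp
  moreover have "card J \<le> b"
    using card_inj_on_le[of f J "{..<b}"] inj_on_subset[OF f(1), of J] by (auto simp: J_def)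
  ultimately show "even k" "k \<le> 2 * b" by auto
qed

section \<open>Ramsey numbers of sets of cycles\<close>

lemma cyclesE:
  assumes "H \<in> \<Gamma>" "\<Gamma> \<subseteq> cycles"
  obtains k where "H = cycle_graph k" "3 \<le> k" "cycle_graph k \<in> \<Gamma>" "min_cycle \<Gamma> \<le> k"
proof -
  obtain k where k: "H = cycle_graph k" "3 \<le> k" using assms by (auto simp: cycles_def)
  then have "min_cycle \<Gamma> \<le> k" using assms(1) unfolding min_cycle_def by (intro Least_le) auto
  then show thesis using that k assms(1) by blast
qed

lemma min_cycle_in:
  assumes "\<Gamma> \<subseteq> cycles" "\<Gamma> \<noteq> {}"
  shows "3 \<le> min_cycle \<Gamma>" "cycle_graph (min_cycle \<Gamma>) \<in> \<Gamma>"
proof -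
  obtain k where "3 \<le> k \<and> cycle_graph k \<in> \<Gamma>"
    using assms cyclesE[OF _ assms(1)] by (metis ex_in_conv)
  then have "3 \<le> min_cycle \<Gamma> \<and> cycle_graph (min_cycle \<Gamma>) \<in> \<Gamma>"
    unfolding min_cycle_def by (rule LeastI)
  then show "3 \<le> min_cycle \<Gamma>" "cycle_graph (min_cycle \<Gamma>) \<in> \<Gamma>" by auto
qed

text \<open>Ramsey's theorem for cliques suffices, as a clique contains a cycle of its own order.
  Existence is what gives the least number in \<open>ramsey_number\<close> its defining
  property.\<close>

lemma ramsey_exists:
  assumes "cycle_graph k \<in> \<Gamma>1" "3 \<le> k" "cycle_graph l \<in> \<Gamma>2" "3 \<le> l"
  shows "\<exists>N>0. \<forall>G :: nat red_blue_graph. finite (vertices G) \<and> card (vertices G) = N \<longrightarrow>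
    (\<exists>H\<in>\<Gamma>1. contains_copy (colour_graph Red G) H) \<or> (\<exists>H\<in>\<Gamma>2. contains_copy (colour_graph Blue G) H)"
proof -
  obtain N where N: "N \<ge> 1" "\<And>(V :: nat set) E. finite V \<Longrightarrow> card V \<ge> N \<Longrightarrow>
      \<exists>W\<subseteq>V. card W = k \<and> clique W E \<or> card W = l \<and> indep W E"
    using ramsey2[of k l] by metis
  show ?thesis
  proof (intro exI[of _ N] conjI allI impI)
    fix G :: "nat red_blue_graph"
    assume G: "finite (vertices G) \<and> card (vertices G) = N"
    let ?E = "{e. edge_colour G e = Red}"
    obtain W where W: "W \<subseteq> vertices G" "card W = k \<and> clique W ?E \<or> card W = l \<and> indep W ?E"
      using N(2)[of "vertices G" ?E] G by auto
    from W(2) show "(\<exists>H\<in>\<Gamma>1. contains_copy (colour_graph Red G) H)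
        \<or> (\<exists>H\<in>\<Gamma>2. contains_copy (colour_graph Blue G) H)"
    proof
      assume "card W = k \<and> clique W ?E"
      then have "has_cycle (\<lambda>x y. edge_colour G {x, y} = Red) W k"
        using assms(2) by (intro has_cycle_clique) (auto simp: clique_def pairwise_def)
      then show ?thesis
        using contains_copy_cycle_graph has_cycle_mono[OF _ W(1)] assms(1,2) by blast
    next
      assume "card W = l \<and> indep W ?E"
      then have "has_cycle (\<lambda>x y. edge_colour G {x, y} = Blue) W l"
        using assms(4) by (intro has_cycle_clique) (auto simp: indep_def pairwise_def intro: colour.exhaust)
      then show ?thesis
        using contains_copy_cycle_graph has_cycle_mono[OF _ W(1)] assms(3,4) by blast
    qed
  qed (use N(1) in simp)
qed

text \<open>On fewer than \<open>min_cycle \<Gamma>1 + b\<close> vertices, the red cycles of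
  \<open>split_graph b\<close> are too short, and its blue cycles are even of length at most
  \<open>2 * b\<close>.\<close>

lemma ramsey_number_gt:
  assumes "\<Gamma>1 \<subseteq> cycles" "\<Gamma>1 \<noteq> {}" "\<Gamma>2 \<subseteq> cycles" "\<Gamma>2 \<noteq> {}"
    and b: "b < min_cycle \<Gamma>1"
    and blue: "\<And>k. 3 \<le> k \<Longrightarrow> even k \<Longrightarrow> cycle_graph k \<in> \<Gamma>2 \<Longrightarrow> 2 * b < k"
  shows "min_cycle \<Gamma>1 + b \<le> ramsey_number \<Gamma>1 \<Gamma>2"
proof (rule ccontr)
  assume less: "\<not> ?thesis"
  let ?r = "ramsey_number \<Gamma>1 \<Gamma>2"
  let ?G = "split_graph b ?r"
  have "\<forall>G :: nat red_blue_graph. finite (vertices G) \<and> card (vertices G) = ?r \<longrightarrow>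
    (\<exists>H\<in>\<Gamma>1. contains_copy (colour_graph Red G) H) \<or> (\<exists>H\<in>\<Gamma>2. contains_copy (colour_graph Blue G) H)"
    using LeastI_ex[OF ramsey_exists[OF min_cycle_in(2,1)[OF assms(1,2)] min_cycle_in(2,1)[OF assms(3,4)]]]
    unfolding ramsey_number_def by blast
  moreover have "finite (vertices ?G)" "card (vertices ?G) = ?r" by (auto simp: split_graph_def)
  ultimately consider H where "H \<in> \<Gamma>1" "contains_copy (colour_graph Red ?G) H"
    | H where "H \<in> \<Gamma>2" "contains_copy (colour_graph Blue ?G) H" by blast
  then show False
  proof cases
    case 1
    obtain k where "H = cycle_graph k" "min_cycle \<Gamma>1 \<le> k" using cyclesE[OF 1(1) assms(1)] .
    then show False using split_graph_red[of b ?r k] 1(2) less b by auto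
  next
    case 2
    obtain k where "H = cycle_graph k" "3 \<le> k" "cycle_graph k \<in> \<Gamma>2" using cyclesE[OF 2(1) assms(3)] .
    then show False using split_graph_blue[of b ?r k] 2(2) blue[of k] by auto
  qed
qed

theorem theorem1p13:
  fixes \<Gamma>1 \<Gamma>2 :: "nat graph set" and G :: "'a red_blue_graph"
  assumes "\<Gamma>1 \<subseteq> cycles" and "\<Gamma>1 \<noteq> {}"
    and "\<Gamma>2 \<subseteq> cycles" and "\<Gamma>2 \<noteq> {}"
    and "critical \<Gamma>1 \<Gamma>2 G"
    and "(min_cycle \<Gamma>1 \<ge> 5 \<and> min_cycle \<Gamma>2 = 3) \<or>
         (min_cycle \<Gamma>1 \<ge> 6 \<and> min_cycle \<Gamma>2 = 5 \<and> min_even_cycle \<Gamma>2 \<ge> 8)"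
  shows "blue_bipartite G"
proof -
  let ?V = "vertices G"
  define R where "R x y \<longleftrightarrow> edge_colour G {x, y} = Red" for x y
  have symp: "symp R" by (auto simp: R_def symp_def insert_commute)
  have Blue: "edge_colour G {x, y} = Blue \<longleftrightarrow> \<not> R x y" for x y
    unfolding R_def by (cases "edge_colour G {x, y}") simp_all
  have fin: "finite ?V" and card: "card ?V = ramsey_number \<Gamma>1 \<Gamma>2 - 1"
    using assms(5) by (auto simp: critical_def)
  have min1: "3 \<le> min_cycle \<Gamma>1" "cycle_graph (min_cycle \<Gamma>1) \<in> \<Gamma>1"
    and min2: "3 \<le> min_cycle \<Gamma>2" "cycle_graph (min_cycle \<Gamma>2) \<in> \<Gamma>2"
    using min_cycle_in assms(1-4) by blast+
  have red: "\<not> has_cycle R ?V (min_cycle \<Gamma>1)"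
    using contains_copy_cycle_graph[of G Red, OF _ min1(1)] min1(2) assms(5)
    unfolding critical_def avoiding_def R_def by blast
  have blue: "\<not> has_cycle (\<lambda>x y. \<not> R x y) ?V (min_cycle \<Gamma>2)"
    using contains_copy_cycle_graph[of G Blue, OF _ min2(1)] min2(2) assms(5)
    unfolding critical_def avoiding_def Blue by blast
  have "two_cliques R ?V"
    using assms(6)
  proof (elim disjE conjE)
    assume m: "5 \<le> min_cycle \<Gamma>1" "min_cycle \<Gamma>2 = 3"
    \<comment> \<open>Here \<open>b = 1\<close>: even cycles have length at least 4.\<close>
    have "min_cycle \<Gamma>1 + 1 \<le> ramsey_number \<Gamma>1 \<Gamma>2"
      using m(1) by (intro ramsey_number_gt[OF assms(1-4)]) auto
    then have "min_cycle \<Gamma>1 \<le> card ?V" using card by simp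
    moreover have "blue_triangle_free R ?V"
      unfolding blue_triangle_free_def
    proof (intro ballI impI, rule ccontr)
      fix x y z assume "x \<in> ?V" "y \<in> ?V" "z \<in> ?V" "distinct [x, y, z]" "\<not> (R x y \<or> R y z \<or> R x z)"
      then have "has_cycle (\<lambda>x y. \<not> R x y) ?V 3"
        using sympD[OF symp, of z x] by (intro has_cycleI[of _ "[x, y, z]"]) (auto simp: is_cycle_def)
      then show False using blue m(2) by simp
    qed
    ultimately show ?thesis using triangle_free_cycles(2)[OF symp fin] m(1) red by blast
  next
    assume m: "6 \<le> min_cycle \<Gamma>1" "min_cycle \<Gamma>2 = 5" "8 \<le> min_even_cycle \<Gamma>2"
    \<comment> \<open>Here \<open>b = 3\<close>: even cycles in \<open>\<Gamma>2\<close> have length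
      at least 8, more than 6.\<close>
    have "min_cycle \<Gamma>1 + 3 \<le> ramsey_number \<Gamma>1 \<Gamma>2"
    proof (rule ramsey_number_gt[OF assms(1-4)])
      fix k assume k: "3 \<le> k" "even k" "cycle_graph k \<in> \<Gamma>2"
      then have "min_even_cycle \<Gamma>2 \<le> enat k"
        unfolding min_even_cycle_def by (intro Inf_lower) auto
      then have "8 \<le> enat k" using m(3) by (rule order_trans[rotated])
      then show "2 * 3 < k" by (simp add: numeral_eq_enat)
    qed (use m(1) in simp)
    then have "min_cycle \<Gamma>1 + 2 \<le> card ?V" using card by simp
    moreover have "blue_pentagon_free R ?V"
      unfolding blue_pentagon_free_def
    proof (intro ballI impI, rule ccontr)
      fix p q r s t
      assume "p \<in> ?V" "q \<in> ?V" "r \<in> ?V" "s \<in> ?V" "t \<in> ?V" "distinct [p, q, r, s, t]"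
        "\<not> (R p q \<or> R q r \<or> R r s \<or> R s t \<or> R t p)"
      then have "has_cycle (\<lambda>x y. \<not> R x y) ?V 5"
        by (intro has_cycleI[of _ "[p, q, r, s, t]"]) (auto simp: is_cycle_def)
      then show False using blue m(2) by simp
    qed
    ultimately show ?thesis using pentagon_free_cycle[OF symp fin] m(1) red by blast
  qed
  then obtain A B where AB: "A \<union> B = ?V" "pairwise R A" "pairwise R B"
    by (auto simp: two_cliques_def)
  \<comment> \<open>The cliques may overlap, so the sides are \<open>A\<close> and
    \<open>B - A\<close>.\<close>
  show ?thesis
    unfolding blue_bipartite_def bipartite_def colour_graph_def
  proof (rule exI[of _ A], rule exI[of _ "B - A"], intro conjI ballI)
    fix e assume "e \<in> snd (?V, {e \<in> nsets ?V 2. edge_colour G e = Blue})"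
    then obtain x y where e: "e = {x, y}" "x \<in> ?V" "y \<in> ?V" "x \<noteq> y" "\<not> R x y"
      using Blue by (auto elim!: nsets2_E)
    then have "\<not> (x \<in> A \<and> y \<in> A)" "\<not> (x \<in> B \<and> y \<in> B)"
      using AB(2,3) unfolding pairwise_def by blast+
    then have "x \<in> A \<and> y \<in> B - A \<or> y \<in> A \<and> x \<in> B - A" using AB(1) e(2,3) by blast
    then show "\<exists>a\<in>A. \<exists>b\<in>B - A. e = {a, b}" using e(1) by blast
  qed (use AB(1) in auto)
qed

end
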